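(* Let $(\omega,c)\in\mathbb{R}^2$ satisfy: $\omega>c^2/4$, or $\omega=c^2/4$ and $c>0$. For $L>L_0(\omega,c)$ let $\Phi^L_{\omega,c}$ be the function on $[-L,L]$ defined below. Then for every integer $m\ge 0$, $$\lim_{L\to\infty}\bigl\|\Phi^L_{\omega,c}-\Phi_{\omega,c}\bigr\|_{H^m([-L,L])}=0.$$
   Context: Set $\alpha_0=\tfrac13(4c+\sqrt{48\omega+4c^2})$, $\alpha_1=4\sqrt\omega+2c$, $A(x)=-3x^2+8cx+64\omega$, $L_0(\omega,c)=2\pi/\sqrt{\alpha_0\sqrt{A(\alpha_0)}}$. For $\eta_3\in(\alpha_0,\alpha_1)$ put $\eta_1=\frac{-\eta_3+4c-\sqrt{A(\eta_3)}}{2}$, $\eta_2=\frac{-\eta_3+4c+\sqrt{A(\eta_3)}}{2}$ (one has $\eta_1<0<\eta_2<\eta_3$), $k^2=\frac{-\eta_1(\eta_3-\eta_2)}{\eta_3(\eta_2-\eta_1)}\in(0,1)$, $g=\frac{2}{\sqrt{\eta_3(\eta_2-\eta_1)}}$, $\beta^2=-\eta_3k^2/\eta_1$, and $T(\eta_3)=4gK(k)$, where $K(k)=\int_0^{\pi/2}(1-k^2\sin^2\theta)^{-1/2}d\theta$. The map $\eta_3\mapsto T(\eta_3)$ is a strictly increasing bijection of $(\alpha_0,\alpha_1)$ onto $(2L_0,\infty)$; for $L>L_0$ let $\eta_3$ be the unique value with $T(\eta_3)=2L$, and define the positive function $\Phi^L_{\omega,c}$ on $[-L,L]$ by $(\Phi^L_{\omega,c}(x))^2=\eta_3\,\mathrm{dn}^2(\frac{x}{2g};k)/(1+\beta^2\mathrm{sn}^2(\frac{x}{2g};k))$,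 with $\mathrm{sn},\mathrm{dn}$ the Jacobi elliptic functions of modulus $k$. (It is a $2L$-periodic solution of $-\Phi''+(\omega-\frac{c^2}4)\Phi+\frac c2\Phi^3-\frac3{16}\Phi^5=0$.) $\Phi_{\omega,c}$ is the function on $\mathbb{R}$ with $\Phi_{\omega,c}>0$ and $\Phi_{\omega,c}^2(x)=\frac{4\omega-c^2}{\sqrt\omega(\cosh(\sqrt{4\omega-c^2}x)-\frac{c}{2\sqrt\omega})}$ if $\omega>c^2/4$, $\Phi_{\omega,c}^2(x)=\frac{4c}{(cx)^2+1}$ if $\omega=c^2/4,\ c>0$. $H^m([-L,L])$ is the standard Sobolev space on the interval. *)

theory Defs
  imports "HOL-Analysis.Analysis"
begin

text \<open>Jacobi elliptic functions, parametrised by the squared modulus k2 = k^2 (0 \<le> k2 < 1).\<close>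

definition ellK :: "real \<Rightarrow> real" where
  "ellK k2 = integral {0..pi/2} (\<lambda>\<theta>. 1 / sqrt (1 - k2 * (sin \<theta>)\<^sup>2))"

definition ellF :: "real \<Rightarrow> real \<Rightarrow> real" where
  "ellF k2 \<phi> = (if 0 \<le> \<phi> then integral {0..\<phi>} (\<lambda>\<theta>. 1 / sqrt (1 - k2 * (sin \<theta>)\<^sup>2))
                 else - integral {\<phi>..0} (\<lambda>\<theta>. 1 / sqrt (1 - k2 * (sin \<theta>)\<^sup>2)))"

definition jam :: "real \<Rightarrow> real \<Rightarrow> real" where
  "jam k2 u = (THE \<phi>. ellF k2 \<phi> = u)"

definition jsn :: "real \<Rightarrow> real \<Rightarrow> real" where
  "jsn k2 u = sin (jam k2 u)"

definition jdn :: "real \<Rightarrow> real \<Rightarrow> real" where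
  "jdn k2 u = sqrt (1 - k2 * (jsn k2 u)\<^sup>2)"

definition alpha0 :: "real \<Rightarrow> real \<Rightarrow> real" where
  "alpha0 \<omega> c = (4*c + sqrt (48*\<omega> + 4*c\<^sup>2)) / 3"

definition alpha1 :: "real \<Rightarrow> real \<Rightarrow> real" where
  "alpha1 \<omega> c = 4 * sqrt \<omega> + 2*c"

definition Apoly :: "real \<Rightarrow> real \<Rightarrow> real \<Rightarrow> real" where
  "Apoly \<omega> c x = -3*x\<^sup>2 + 8*c*x + 64*\<omega>"

definition L0 :: "real \<Rightarrow> real \<Rightarrow> real" where
  "L0 \<omega> c = 2*pi / sqrt (alpha0 \<omega> c * sqrt (Apoly \<omega> c (alpha0 \<omega> c)))"

definition eta1 :: "real \<Rightarrow> real \<Rightarrow> real \<Rightarrow> real" where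
  "eta1 \<omega> c e3 = (- e3 + 4*c - sqrt (Apoly \<omega> c e3)) / 2"

definition eta2 :: "real \<Rightarrow> real \<Rightarrow> real \<Rightarrow> real" where
  "eta2 \<omega> c e3 = (- e3 + 4*c + sqrt (Apoly \<omega> c e3)) / 2"

definition ksq :: "real \<Rightarrow> real \<Rightarrow> real \<Rightarrow> real" where
  "ksq \<omega> c e3 = (- eta1 \<omega> c e3 * (e3 - eta2 \<omega> c e3)) / (e3 * (eta2 \<omega> c e3 - eta1 \<omega> c e3))"

definition gfun :: "real \<Rightarrow> real \<Rightarrow> real \<Rightarrow> real" where
  "gfun \<omega> c e3 = 2 / sqrt (e3 * (eta2 \<omega> c e3 - eta1 \<omega> c e3))"

definition betasq :: "real \<Rightarrow> real \<Rightarrow> real \<Rightarrow> real" where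
  "betasq \<omega> c e3 = - e3 * ksq \<omega> c e3 / eta1 \<omega> c e3"

definition Tper :: "real \<Rightarrow> real \<Rightarrow> real \<Rightarrow> real" where
  "Tper \<omega> c e3 = 4 * gfun \<omega> c e3 * ellK (ksq \<omega> c e3)"

text \<open>The unique eta3 in (alpha0, alpha1) with T(eta3) = 2L (meaningful for L > L0).\<close>
definition eta3L :: "real \<Rightarrow> real \<Rightarrow> real \<Rightarrow> real" where
  "eta3L \<omega> c L = (THE e3. alpha0 \<omega> c < e3 \<and> e3 < alpha1 \<omega> c \<and> Tper \<omega> c e3 = 2*L)"

definition PhiL :: "real \<Rightarrow> real \<Rightarrow> real \<Rightarrow> real \<Rightarrow> real" where
  "PhiL \<omega> c L x =
     (let e3 = eta3L \<omega> c L; k2 = ksq \<omega> c e3; g = gfun \<omega> c e3; b2 = betasq \<omega> c e3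
      in sqrt (e3 * (jdn k2 (x / (2*g)))\<^sup>2 / (1 + b2 * (jsn k2 (x / (2*g)))\<^sup>2)))"

definition Phi :: "real \<Rightarrow> real \<Rightarrow> real \<Rightarrow> real" where
  "Phi \<omega> c x =
     (if \<omega> > c\<^sup>2 / 4 then
        sqrt ((4*\<omega> - c\<^sup>2) / (sqrt \<omega> * (cosh (sqrt (4*\<omega> - c\<^sup>2) * x) - c / (2 * sqrt \<omega>))))
      else sqrt (4*c / ((c*x)\<^sup>2 + 1)))"

text \<open>H^m([-L,L]) norm of a smooth function (classical derivatives).\<close>
definition Hm_norm :: "nat \<Rightarrow> real \<Rightarrow> (real \<Rightarrow> real) \<Rightarrow> real" where
  "Hm_norm m L f = sqrt (\<Sum>j\<le>m. integral {-L..L} (\<lambda>x. ((deriv ^^ j) f x)\<^sup>2))"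

end

theory Submission
  imports Defs
begin

text \<open>
  Both waves solve the same equation u'' = f(u) with u'(0) = 0, so by continuous dependence on the
  initial value (a Gronwall estimate) they are close in C^1 on every compact interval as soon as
  eta3(L) tends to alpha1, which follows from the strict monotonicity and divergence of the period
  map. Since 1 / Phi_L^2 = 1 / eta3 + B sn^2 / dn^2 and sn / dn is bounded below by a linear function
  on a half period, Phi_L^2 is at most D / (1 + x^2) on [-L, L] uniformly in L. The energy identity gives
  |u'| at most a constant times |u|, and every higher derivative is a polynomial in (u, u') without
  constant term, so all derivatives inherit this domination and the tails of the integrals are
  uniformly small.

  For the monotonicity write T = 8 int (p cos^2 + q sin^2)^(-1/2) over [0, pi/2] with
  p = eta3 (eta2 - eta1) and q = eta2 (eta3 - eta1): as eta3 grows, q and p + q decrease, and spreading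
  p and q apart at constant sum increases the integral.
\<close>

subsection \<open>Jacobi elliptic functions\<close>

text \<open>The two admissible cases degenerate differently as eta3 approaches alpha1. If \<omega> >
  c^2/4, the squared modulus tends to 1 while g stays bounded; if \<omega> = c^2/4, it tends to 1/2
  while g diverges. A limit taken directly in the elliptic formulas would have to separate them. The
  proof relies instead on quantities that behave alike in both: upper bounds for the coefficients of
  the period integral, the quotient B / g^2 in the decay estimate, and the differential equation,
  whose coefficients do not depend on L. The weight 1 / (1 + x^2) is the exact decay rate of the
  squared solitary wave in the borderline case. A decay bound uniform in L cannot be avoided,
  because the Gronwall bound grows exponentially in |x| and says nothing useful near the ends of
  [-L, L].\<close>

lemma one_minus_sin_sq_pos:
  fixes k t :: real
  assumes "0 \<le> k" "k < 1"
  shows "0 < 1 - k * (sin t)\<^sup>2"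
proof -
  have "k * (sin t)\<^sup>2 \<le> k * 1"
    by (intro mult_left_mono) (use assms in \<open>auto simp: abs_square_le_1\<close>)
  then show ?thesis using assms by linarith
qed

lemma continuous_on_ellF_integrand:
  fixes k :: real
  assumes "0 \<le> k" "k < 1"
  shows "continuous_on S (\<lambda>\<theta>. 1 / sqrt (1 - k * (sin \<theta>)\<^sup>2))"
  by (intro continuous_intros) (use one_minus_sin_sq_pos[OF assms] in \<open>simp add: order_less_imp_not_eq2\<close>)

lemma ellF_0 [simp]: "ellF k 0 = 0"
  by (simp add: ellF_def)

lemma ellF_minus: "ellF k (- \<phi>) = - ellF k \<phi>"
proof -
  have "integral {-\<phi>..0} (\<lambda>\<theta>. 1 / sqrt (1 - k * (sin \<theta>)\<^sup>2))
      = integral {0..\<phi>} (\<lambda>\<theta>. 1 / sqrt (1 - k * (sin \<theta>)\<^sup>2))" for \<phi> :: real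
    using Henstock_Kurzweil_Integration.integral_reflect_real[of \<phi> 0 "\<lambda>\<theta>. 1 / sqrt (1 - k * (sin \<theta>)\<^sup>2)"] by simp
  from this[of \<phi>] this[of "-\<phi>"] show ?thesis
    by (cases "\<phi> = 0") (auto simp: ellF_def)
qed

lemma DERIV_ellF:
  assumes k: "0 \<le> k" "k < 1"
  shows "(ellF k has_real_derivative 1 / sqrt (1 - k * (sin \<phi>)\<^sup>2)) (at \<phi>)"
proof -
  let ?h = "\<lambda>\<theta>. 1 / sqrt (1 - k * (sin \<theta>)\<^sup>2)"
  \<comment> \<open>With a base point below both 0 and \<phi>, the two branches of
    \<open>ellF\<close> become one antiderivative minus a constant, so differentiability at 0 needs
    no separate argument.\<close>
  define M where "M = \<bar>\<phi>\<bar> + 1"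
  have cont: "continuous_on S ?h" for S
    by (rule continuous_on_ellF_integrand[OF k])
  have M: "\<phi> \<in> {-M<..<M}" "M > 0" by (auto simp: M_def)
  have "((\<lambda>x. integral {-M..x} ?h) has_real_derivative ?h \<phi>) (at \<phi> within {-M..M})"
    by (rule integral_has_real_derivative[OF cont]) (use M in auto)
  then have "((\<lambda>x. integral {-M..x} ?h) has_real_derivative ?h \<phi>) (at \<phi>)"
    using M by (subst (asm) at_within_interior) auto
  then have "((\<lambda>x. integral {-M..x} ?h - integral {-M..0} ?h) has_real_derivative ?h \<phi>) (at \<phi>)"
    by (auto intro!: derivative_eq_intros)
  then show ?thesis
  proof (rule has_field_derivative_transform_within_open[of _ _ _ "{-M<..<M}"])
    fix x assume x: "x \<in> {-M<..<M}"
    have int: "?h integrable_on {a..b}" for a b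
      by (rule integrable_continuous_interval[OF cont])
    show "integral {-M..x} ?h - integral {-M..0} ?h = ellF k x"
    proof (cases "0 \<le> x")
      case True
      then show ?thesis
        using Henstock_Kurzweil_Integration.integral_combine[of "-M" 0 x ?h, OF _ _ int] M by (simp add: ellF_def)
    next
      case False
      then show ?thesis
        using Henstock_Kurzweil_Integration.integral_combine[of "-M" x 0 ?h, OF _ _ int] M x by (simp add: ellF_def)
    qed
  qed (use M in auto)
qed

lemma ellF_strict_mono:
  assumes k: "0 \<le> k" "k < 1" and "a < b"
  shows "ellF k a < ellF k b"
proof (rule DERIV_pos_imp_increasing[OF \<open>a < b\<close>])
  fix x
  show "\<exists>y. (ellF k has_real_derivative y) (at x) \<and> 0 < y"
    using DERIV_ellF[OF k, of x] one_minus_sin_sq_pos[OF k, of x] by (intro exI conjI) auto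
qed

text \<open>The integrand is at least 1. This makes \<open>u\<close> itself an upper bracket for the
  intermediate value theorem in \<open>ellF_surj\<close>.\<close>

lemma ellF_ge:
  assumes k: "0 \<le> k" "k < 1" and "0 \<le> \<phi>"
  shows "\<phi> \<le> ellF k \<phi>"
proof -
  have "ellF k 0 - 0 \<le> ellF k \<phi> - \<phi>"
  proof (rule DERIV_nonneg_imp_nondecreasing[OF \<open>0 \<le> \<phi>\<close>])
    fix x :: real
    have "((\<lambda>x. ellF k x - x) has_real_derivative 1 / sqrt (1 - k * (sin x)\<^sup>2) - 1) (at x)"
      by (auto intro!: derivative_eq_intros DERIV_ellF k)
    moreover have "1 / sqrt (1 - k * (sin x)\<^sup>2) - 1 \<ge> 0"
      using one_minus_sin_sq_pos[OF k, of x] k(1) by (auto simp: field_simps)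
    ultimately show "\<exists>y. ((\<lambda>x. ellF k x - x) has_real_derivative y) (at x) \<and> 0 \<le> y" by blast
  qed
  then show ?thesis by simp
qed

lemma ellF_surj:
  assumes k: "0 \<le> k" "k < 1"
  shows "\<exists>\<phi>. ellF k \<phi> = u"
proof -
  have pos: "\<exists>\<phi>. ellF k \<phi> = u" if "u \<ge> 0" for u
    using IVT[of "ellF k" 0 u u] that ellF_ge[OF k that] DERIV_isCont[OF DERIV_ellF[OF k]] by auto
  show ?thesis
  proof (cases "u \<ge> 0")
    case False
    then obtain \<phi> where "ellF k \<phi> = - u" using pos[of "-u"] by auto
    then have "ellF k (-\<phi>) = u" by (simp add: ellF_minus)
    then show ?thesis by blast
  qed (use pos in auto)
qed

section \<open>The Jacobi amplitude as inverse function of \<open>ellF\<close>\<close>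

lemma jam_ellF:
  assumes k: "0 \<le> k" "k < 1"
  shows "jam k (ellF k \<phi>) = \<phi>"
  unfolding jam_def
proof (rule the_equality)
  fix \<psi> assume "ellF k \<psi> = ellF k \<phi>"
  then show "\<psi> = \<phi>"
    using ellF_strict_mono[OF k, of \<psi> \<phi>] ellF_strict_mono[OF k, of \<phi> \<psi>] by linarith
qed simp

lemma ellF_jam:
  assumes k: "0 \<le> k" "k < 1"
  shows "ellF k (jam k u) = u"
  using ellF_surj[OF k, of u] jam_ellF[OF k] by metis

lemma jam_0 [simp]: "0 \<le> k \<Longrightarrow> k < 1 \<Longrightarrow> jam k 0 = 0"
  using jam_ellF[of k 0] by simp

lemma jam_minus: "0 \<le> k \<Longrightarrow> k < 1 \<Longrightarrow> jam k (- u) = - jam k u"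
  by (metis ellF_minus ellF_jam jam_ellF)

text \<open>The reciprocal of the integrand at the inverse point, that is, dn. Every derivative of
  the periodic wave is computed from this formula.\<close>

lemma DERIV_jam:
  assumes k: "0 \<le> k" "k < 1"
  shows "(jam k has_real_derivative sqrt (1 - k * (sin (jam k u))\<^sup>2)) (at u)"
proof -
  have "isCont (jam k) (ellF k (jam k u))"
    by (rule isCont_inverse_function[of 1])
       (use jam_ellF[OF k] DERIV_isCont[OF DERIV_ellF[OF k]] in auto)
  then have cont: "isCont (jam k) u" by (simp add: ellF_jam[OF k])
  have "(jam k has_real_derivative inverse (1 / sqrt (1 - k * (sin (jam k u))\<^sup>2))) (at u)"
    by (rule DERIV_inverse_function[where f = "ellF k" and a = "u - 1" and b = "u + 1", OF DERIV_ellF[OF k]])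
       (use one_minus_sin_sq_pos[OF k, of "jam k u"] cont ellF_jam[OF k] in auto)
  then show ?thesis by simp
qed

text \<open>Concavity puts sin above its chord from 0 to pi/2.\<close>

lemma Jordan_sin_ge:
  fixes x :: real
  assumes "0 \<le> x" "x \<le> pi / 2"
  shows "2 / pi * x \<le> sin x"
proof -
  have "concave_on {0..pi} sin"
    by (intro f''_le0_imp_concave[where f' = cos and f'' = "\<lambda>x. - sin x"])
       (auto intro!: derivative_eq_intros sin_ge_zero)
  then have "sin ((1 - 2 / pi * x) *\<^sub>R 0 + (2 / pi * x) *\<^sub>R (pi / 2)) \<ge> (1 - 2 / pi * x) * sin 0 + (2 / pi * x) * sin (pi / 2)"
    using assms by (intro concave_onD[where A = "{0..pi}"]) (auto simp: field_simps)
  then show ?thesis by simp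
qed

text \<open>On [0, pi/2] the integrand of ellF is increasing, so F(phi) is at most phi times its last value,
  and Jordan's inequality applies.\<close>

lemma jsn_over_jdn_ge:
  assumes k: "0 \<le> k" "k < 1" and u: "\<bar>u\<bar> \<le> ellK k"
  shows "(2 / pi * u)\<^sup>2 \<le> (jsn k u)\<^sup>2 / (1 - k * (jsn k u)\<^sup>2)"
proof -
  have main: "(2 / pi * u)\<^sup>2 \<le> (jsn k u)\<^sup>2 / (1 - k * (jsn k u)\<^sup>2)"
    if u: "0 \<le> u" "u \<le> ellK k" for u
  proof -
    define \<phi> where "\<phi> = jam k u"
    have F: "ellF k \<phi> = u" by (simp add: \<phi>_def ellF_jam[OF k])
    have K: "ellF k (pi/2) = ellK k" by (simp add: ellF_def ellK_def)
    have \<phi>0: "0 \<le> \<phi>" using ellF_strict_mono[OF k, of \<phi> 0] F u by (cases "\<phi> < 0") auto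
    have \<phi>1: "\<phi> \<le> pi/2" using ellF_strict_mono[OF k, of "pi/2" \<phi>] F u K by (cases "\<phi> \<le> pi/2") auto
    let ?h = "\<lambda>\<theta>. 1 / sqrt (1 - k * (sin \<theta>)\<^sup>2)"
    have "u = integral {0..\<phi>} ?h" using F \<phi>0 by (simp add: ellF_def)
    also have "\<dots> \<le> integral {0..\<phi>} (\<lambda>_. ?h \<phi>)"
    proof (rule integral_le)
      fix x assume x: "x \<in> {0..\<phi>}"
      have "sin x \<le> sin \<phi>" "0 \<le> sin x"
        using x \<phi>1 by (auto intro!: sin_monotone_2pi_le sin_ge_zero)
      then have "k * (sin x)\<^sup>2 \<le> k * (sin \<phi>)\<^sup>2"
        using k by (intro mult_left_mono power_mono) auto
      then show "?h x \<le> ?h \<phi>"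
        using one_minus_sin_sq_pos[OF k, of \<phi>] by (intro divide_left_mono) auto
    qed (auto intro!: integrable_continuous_interval continuous_on_ellF_integrand k)
    also have "\<dots> = \<phi> * ?h \<phi>" using \<phi>0 by simp
    finally have "2 / pi * u \<le> 2 / pi * (\<phi> * ?h \<phi>)" by (intro mult_left_mono) auto
    also have "\<dots> \<le> sin \<phi> * ?h \<phi>"
      using mult_right_mono[OF Jordan_sin_ge[OF \<phi>0 \<phi>1], of "?h \<phi>"] one_minus_sin_sq_pos[OF k, of \<phi>]
      by (simp add: mult.assoc)
    finally have "(2 / pi * u)\<^sup>2 \<le> (sin \<phi> * ?h \<phi>)\<^sup>2"
      using u by (intro power_mono) auto
    also have "\<dots> = (sin \<phi>)\<^sup>2 / (1 - k * (sin \<phi>)\<^sup>2)"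
      using one_minus_sin_sq_pos[OF k, of \<phi>] by (simp add: power_mult_distrib power_divide)
    finally show ?thesis by (simp add: jsn_def \<phi>_def)
  qed
  show ?thesis
    using main[of u] main[of "-u"] u by (cases "u \<ge> 0") (auto simp: jsn_def jam_minus[OF k])
qed

subsection \<open>Monotonicity of the complete elliptic integral\<close>

text \<open>Gauss's form of the complete elliptic integral: for p = a^2 and q = b^2 with a, b > 0 it
  is pi / (2 AGM(a, b)). Unlike the form with a modulus it is symmetric in its arguments.\<close>

definition agm_integral :: "real \<Rightarrow> real \<Rightarrow> real" where
  "agm_integral p q = integral {0..pi/2} (\<lambda>\<theta>. 1 / sqrt (p * (cos \<theta>)\<^sup>2 + q * (sin \<theta>)\<^sup>2))"

lemma cos_sin_quadratic_pos:
  fixes p q t :: real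
  assumes "0 < p" "0 < q"
  shows "0 < p * (cos t)\<^sup>2 + q * (sin t)\<^sup>2"
proof (cases "sin t = 0")
  case True
  then have "(cos t)\<^sup>2 = 1" using sin_cos_squared_add[of t] by simp
  then show ?thesis using assms True by simp
next
  case False
  then show ?thesis using assms by (intro add_nonneg_pos) auto
qed

lemma continuous_on_agm_integrand:
  fixes p q :: real
  assumes "0 < p" "0 < q"
  shows "continuous_on S (\<lambda>\<theta>. 1 / sqrt (p * (cos \<theta>)\<^sup>2 + q * (sin \<theta>)\<^sup>2))"
  by (intro continuous_intros)
     (use cos_sin_quadratic_pos[OF assms] in \<open>simp add: order_less_imp_not_eq2\<close>)

text \<open>The substitution of pi/2 - \<theta> for \<theta>, carried out as a reflection and a
  shift by pi/2.\<close>

lemma agm_integral_commute: "agm_integral p q = agm_integral q p"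
proof -
  let ?f = "\<lambda>\<theta>. 1 / sqrt (p * (cos \<theta>)\<^sup>2 + q * (sin \<theta>)\<^sup>2)"
  have "agm_integral p q = integral {-(pi/2)..-0} (\<lambda>x. ?f (- x))"
    unfolding agm_integral_def by (rule Henstock_Kurzweil_Integration.integral_reflect_real[symmetric])
  also have "\<dots> = integral {-(pi/2)..0} (\<lambda>x. 1 / sqrt (p * (sin (x + pi/2))\<^sup>2 + q * (cos (x + pi/2))\<^sup>2))"
    by (simp add: sin_add cos_add)
  also have "\<dots> = integral {-(pi/2)+pi/2..0+pi/2} (\<lambda>x. 1 / sqrt (p * (sin x)\<^sup>2 + q * (cos x)\<^sup>2))"
    using integral_shift_real_ivl[of "-(pi/2)+pi/2" "pi/2" "0+pi/2" "\<lambda>x. 1 / sqrt (p * (sin x)\<^sup>2 + q * (cos x)\<^sup>2)"]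
    by simp
  finally show ?thesis
    by (simp add: agm_integral_def add.commute)
qed

text \<open>The q-term vanishes at \<theta> = 0 and p may equal p', so strict order of the
  integrands can fail there; the open interval suffices.\<close>

lemma agm_integral_strict_antimono:
  assumes "0 < p'" "p' \<le> p" "0 < q'" "q' < q"
  shows "agm_integral p q < agm_integral p' q'"
  unfolding agm_integral_def
proof (rule integral_less_real)
  fix x :: real assume x: "x \<in> {0<..<pi/2}"
  then have "0 < sin x" by (intro sin_gt_zero) auto
  then have "p' * (cos x)\<^sup>2 + q' * (sin x)\<^sup>2 < p * (cos x)\<^sup>2 + q * (sin x)\<^sup>2"
    using assms by (intro add_le_less_mono mult_right_mono mult_strict_right_mono) auto
  then show "1 / sqrt (p * (cos x)\<^sup>2 + q * (sin x)\<^sup>2) < 1 / sqrt (p' * (cos x)\<^sup>2 + q' * (sin x)\<^sup>2)"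
    using cos_sin_quadratic_pos[of p' q' x] assms by (intro divide_strict_left_mono) auto
qed (use assms pi_gt_zero in \<open>auto intro!: continuous_on_agm_integrand simp del: pi_gt_zero\<close>)

text \<open>The square of the left side is (X + Y) / (X Y) + 2 / sqrt (X Y), which at fixed sum
  grows as the product shrinks.\<close>

lemma inverse_sqrt_sum_le:
  fixes X Y X' Y' :: real
  assumes pos: "0 < X" "0 < Y" "0 < X'" "0 < Y'" and sum: "X + Y = X' + Y'" and prod: "X' * Y' \<le> X * Y"
  shows "1 / sqrt X + 1 / sqrt Y \<le> 1 / sqrt X' + 1 / sqrt Y'"
proof (rule power2_le_imp_le)
  have sq: "(1 / sqrt a + 1 / sqrt b)\<^sup>2 = (a + b) / (a * b) + 2 / sqrt (a * b)" if "0 < a" "0 < b" for a b :: real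
    using that by (simp add: power2_sum power_divide real_sqrt_mult add_divide_distrib)
  have "(X + Y) / (X * Y) \<le> (X' + Y') / (X' * Y')"
    using assms by (auto intro!: divide_left_mono)
  moreover have "2 / sqrt (X * Y) \<le> 2 / sqrt (X' * Y')"
    using assms by (auto intro!: divide_left_mono)
  ultimately show "(1 / sqrt X + 1 / sqrt Y)\<^sup>2 \<le> (1 / sqrt X' + 1 / sqrt Y')\<^sup>2"
    unfolding sq[OF pos(1,2)] sq[OF pos(3,4)] by linarith
qed (use pos in auto)

text \<open>Averaging the integrand over the symmetry that exchanges cos and sin makes this a pointwise inequality.\<close>

lemma agm_integral_spread:
  assumes "q \<le> p" "0 \<le> d" "d < q"
  shows "agm_integral p q \<le> agm_integral (p + d) (q - d)"
proof -
  let ?f = "\<lambda>p q \<theta>::real. 1 / sqrt (p * (cos \<theta>)\<^sup>2 + q * (sin \<theta>)\<^sup>2)"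
  have int: "?f a b integrable_on {0..pi/2}" if "0 < a" "0 < b" for a b
    using that by (intro integrable_continuous_interval continuous_on_agm_integrand)
  have twice: "2 * agm_integral a b = integral {0..pi/2} (\<lambda>\<theta>. ?f a b \<theta> + ?f b a \<theta>)" if "0 < a" "0 < b" for a b
    using that agm_integral_commute[of a b] by (subst Henstock_Kurzweil_Integration.integral_add) (auto intro: int simp: agm_integral_def)
  have "integral {0..pi/2} (\<lambda>\<theta>. ?f p q \<theta> + ?f q p \<theta>)
      \<le> integral {0..pi/2} (\<lambda>\<theta>. ?f (p + d) (q - d) \<theta> + ?f (q - d) (p + d) \<theta>)"
  proof (rule integral_le)
    fix t :: real
    define C S where "C = (cos t)\<^sup>2" and "S = (sin t)\<^sup>2"
    have CS: "S = 1 - C" by (simp add: C_def S_def sin_squared_eq)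
    have "(p * C + q * S) * (q * C + p * S) - ((p + d) * C + (q - d) * S) * ((q - d) * C + (p + d) * S)
        = d * (p - q + d) * (C - S)\<^sup>2"
      unfolding CS by (simp add: power2_eq_square algebra_simps)
    also have "\<dots> \<ge> 0" using assms by simp
    finally have "((p + d) * C + (q - d) * S) * ((q - d) * C + (p + d) * S) \<le> (p * C + q * S) * (q * C + p * S)"
      by simp
    moreover have "p * C + q * S + (q * C + p * S) = (p + d) * C + (q - d) * S + ((q - d) * C + (p + d) * S)"
      by (simp add: algebra_simps)
    ultimately show "?f p q t + ?f q p t \<le> ?f (p + d) (q - d) t + ?f (q - d) (p + d) t"
      using assms unfolding C_def S_def by (intro inverse_sqrt_sum_le cos_sin_quadratic_pos) auto
  qed (use assms in \<open>auto intro!: integrable_add int\<close>)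
  with twice[of p q] twice[of "p + d" "q - d"] assms show ?thesis by simp
qed

text \<open>If p' \<le> p, neither coefficient grows. Otherwise spread the pair by p' - p at
  constant sum: the first coefficient becomes p', the second stays above q' by the hypothesis on the
  sums, and lowering it to q' gives strictness.\<close>

lemma agm_integral_less:
  assumes "0 < p'" "0 < q'" "q' < q" "q \<le> p" "p' + q' < p + q"
  shows "agm_integral p q < agm_integral p' q'"
proof (cases "p' \<le> p")
  case True
  then show ?thesis using assms by (intro agm_integral_strict_antimono) auto
next
  case False
  have "agm_integral p q \<le> agm_integral (p + (p' - p)) (q - (p' - p))"
    using assms False by (intro agm_integral_spread) auto
  also have "\<dots> < agm_integral p' q'"
    using assms False by (intro agm_integral_strict_antimono) auto
  finally show ?thesis .
qed

text \<open>Since cos \<theta> \<le> pi/2 - \<theta> and the q-term is at most P d^2, the square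
  root is at most sqrt P * (pi/2 - \<theta> + d). Its reciprocal integrates to a logarithm that is
  unbounded as d tends to 0. Apart from positivity only upper bounds on p and q enter, so p may tend
  to 0 as well.\<close>

lemma agm_integral_ge_ln:
  assumes pq: "0 < p" "0 < q" "p \<le> P" "q \<le> P * d\<^sup>2" and d: "0 < d"
  shows "(ln (pi/2 + d) - ln d) / sqrt P \<le> agm_integral p q"
proof -
  have P: "0 < P" using pq by simp
  define r where "r = sqrt P"
  have r: "0 < r" using P by (simp add: r_def)
  have "((\<lambda>\<theta>. 1 / (r * (pi/2 - \<theta> + d))) has_integral
      (- ln (pi/2 - pi/2 + d) / r - (- ln (pi/2 - 0 + d) / r))) {0..pi/2}"
  proof (rule fundamental_theorem_of_calculus)
    fix x assume "x \<in> {0..pi/2}"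
    then have "((\<lambda>x. ln (pi/2 - x + d)) has_real_derivative - (1 / (pi/2 - x + d))) (at x within {0..pi/2})"
      using d by (auto intro!: derivative_eq_intros)
    from DERIV_cdivide[OF DERIV_minus[OF this], of r]
    show "((\<lambda>x. - ln (pi/2 - x + d) / r) has_vector_derivative 1 / (r * (pi/2 - x + d))) (at x within {0..pi/2})"
      unfolding has_real_derivative_iff_has_vector_derivative[symmetric] by (simp add: mult.commute)
  qed simp
  then have int: "((\<lambda>\<theta>. 1 / (sqrt P * (pi/2 - \<theta> + d))) has_integral (ln (pi/2 + d) - ln d) / sqrt P) {0..pi/2}"
    by (simp add: diff_divide_distrib r_def)
  show ?thesis
    unfolding agm_integral_def
  proof (rule has_integral_le[OF int integrable_integral])
    fix x assume x: "x \<in> {0..pi/2}"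
    have "cos x = sin (pi/2 - x)" by (simp add: cos_sin_eq)
    also have "\<dots> \<le> pi/2 - x" using x by (intro sin_x_le_x) auto
    finally have c: "cos x \<le> pi/2 - x" .
    have c0: "0 \<le> cos x" using x by (intro cos_ge_zero) auto
    have "p * (cos x)\<^sup>2 + q * (sin x)\<^sup>2 \<le> P * (cos x)\<^sup>2 + (P * d\<^sup>2) * 1"
      using pq P by (intro add_mono mult_mono) (auto simp: abs_square_le_1)
    also have "\<dots> \<le> P * (cos x + d)\<^sup>2"
      using P c0 d by (simp add: power2_sum algebra_simps)
    also have "\<dots> \<le> P * (pi/2 - x + d)\<^sup>2"
      using P c c0 d by (intro mult_left_mono power_mono) auto
    finally have "sqrt (p * (cos x)\<^sup>2 + q * (sin x)\<^sup>2) \<le> sqrt (P * (pi/2 - x + d)\<^sup>2)"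
      by simp
    also have "\<dots> = sqrt P * (pi/2 - x + d)" using x d by (simp add: real_sqrt_mult)
    finally show "1 / (sqrt P * (pi/2 - x + d)) \<le> 1 / sqrt (p * (cos x)\<^sup>2 + q * (sin x)\<^sup>2)"
      using cos_sin_quadratic_pos[OF pq(1,2), of x] by (intro divide_left_mono) (use x d P in auto)
  qed (use pq in \<open>auto intro!: integrable_continuous_interval continuous_on_agm_integrand\<close>)
qed

lemma continuous_on_agm_integral:
  fixes p q :: "real \<Rightarrow> real"
  assumes "continuous_on U p" "continuous_on U q" "\<And>e. e \<in> U \<Longrightarrow> 0 < p e" "\<And>e. e \<in> U \<Longrightarrow> 0 < q e"
  shows "continuous_on U (\<lambda>e. agm_integral (p e) (q e))"
proof -
  have "continuous_on (U \<times> cbox 0 (pi/2)) (\<lambda>(e, \<theta>). 1 / sqrt (p e * (cos \<theta>)\<^sup>2 + q e * (sin \<theta>)\<^sup>2))"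
    unfolding case_prod_beta
  proof (intro continuous_intros)
    show "continuous_on (U \<times> cbox 0 (pi/2)) (\<lambda>x. p (fst x))" "continuous_on (U \<times> cbox 0 (pi/2)) (\<lambda>x. q (fst x))"
      by (auto intro!: continuous_on_compose2[OF assms(1)] continuous_on_compose2[OF assms(2)] continuous_intros)
    show "\<forall>x\<in>U \<times> cbox 0 (pi/2). sqrt (p (fst x) * (cos (snd x))\<^sup>2 + q (fst x) * (sin (snd x))\<^sup>2) \<noteq> 0"
      using cos_sin_quadratic_pos assms(3,4) by (auto simp: order_less_imp_not_eq2)
  qed
  from integral_continuous_on_param[OF this] show ?thesis
    by (simp add: agm_integral_def)
qed

subsection \<open>The period map\<close>

locale wave_parameters =
  fixes \<omega> c :: real
  assumes admissible: "\<omega> > c\<^sup>2 / 4 \<or> (\<omega> = c\<^sup>2 / 4 \<and> c > 0)"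
begin

section \<open>Inequalities between \<omega>, c and the end points alpha0, alpha1\<close>

lemma omega_pos: "0 < \<omega>"
proof -
  have "0 \<le> c\<^sup>2" "c \<noteq> 0 \<Longrightarrow> 0 < c\<^sup>2" by auto
  then show ?thesis using admissible by linarith
qed

lemma c_sq_le: "c\<^sup>2 \<le> 4 * \<omega>"
  using admissible by auto

text \<open>The value \<open>- 2 * sqrt \<omega>\<close> would be the borderline \<omega> = c^2/4
  with negative c, which is not admissible. This one-sided strictness keeps alpha1 positive.\<close>

lemma c_le: "c \<le> 2 * sqrt \<omega>"
  and c_gt: "- 2 * sqrt \<omega> < c"
proof -
  have "(2 * sqrt \<omega>)\<^sup>2 = 4 * \<omega>" using omega_pos by (simp add: power_mult_distrib)
  then have "\<bar>c\<bar> \<le> \<bar>2 * sqrt \<omega>\<bar>"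
    using c_sq_le by (simp only: abs_le_square_iff)
  then have b: "\<bar>c\<bar> \<le> 2 * sqrt \<omega>" using omega_pos by simp
  then show "c \<le> 2 * sqrt \<omega>" by simp
  have "c \<noteq> - 2 * sqrt \<omega>"
  proof
    assume c: "c = - 2 * sqrt \<omega>"
    then have "c\<^sup>2 = 4 * \<omega>" using omega_pos by (simp add: power_mult_distrib)
    then have "c > 0" using admissible by auto
    with c omega_pos show False by simp
  qed
  with b show "- 2 * sqrt \<omega> < c" by simp
qed

lemma alpha1_pos: "0 < alpha1 \<omega> c"
  using c_gt by (simp add: alpha1_def)

lemma alpha0_nonneg: "0 \<le> alpha0 \<omega> c" and alpha0_ge: "4 * c \<le> 3 * alpha0 \<omega> c"
proof -
  have "\<bar>4 * c\<bar> \<le> sqrt (48 * \<omega> + 4 * c\<^sup>2)"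
    using c_sq_le by (intro real_le_rsqrt) (simp add: power_mult_distrib abs_mult)
  then have "0 \<le> 4 * c + sqrt (48 * \<omega> + 4 * c\<^sup>2)" "0 \<le> sqrt (48 * \<omega> + 4 * c\<^sup>2)" by linarith+
  then show "0 \<le> alpha0 \<omega> c" "4 * c \<le> 3 * alpha0 \<omega> c" by (simp_all add: alpha0_def)
qed

lemma alpha0_less_alpha1: "alpha0 \<omega> c < alpha1 \<omega> c"
proof -
  define w where "w = sqrt \<omega>"
  have w: "0 < w" "\<omega> = w\<^sup>2" using omega_pos by (auto simp: w_def)
  \<comment> \<open>48 times this product is (12 w + 2 c)^2 - (48 w^2 + 4 c^2).\<close>
  have "0 < w * (2 * w + c)" using w(1) c_gt unfolding w_def by (intro mult_pos_pos) auto
  then have "48 * \<omega> + 4 * c\<^sup>2 < (12 * w + 2 * c)\<^sup>2"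
    by (simp add: w(2) power2_eq_square algebra_simps)
  moreover have "0 \<le> 12 * w + 2 * c" using c_gt w(1) unfolding w_def by linarith
  ultimately have "sqrt (48 * \<omega> + 4 * c\<^sup>2) < 12 * w + 2 * c" by (intro real_less_lsqrt)
  then show ?thesis by (simp add: alpha0_def alpha1_def w_def)
qed

section \<open>The roots eta1 and eta2 as functions of eta3\<close>

abbreviation "\<eta>\<^sub>1 \<equiv> eta1 \<omega> c"
abbreviation "\<eta>\<^sub>2 \<equiv> eta2 \<omega> c"
abbreviation "eta3_range \<equiv> {alpha0 \<omega> c<..<alpha1 \<omega> c}"

text \<open>Together with \<open>eta_pair_sum\<close> these are Vieta's relations: eta1, eta2 and e
  are the roots of a monic cubic in which only the constant term depends on e. Monotonicity is
  derived from these relations, so the square roots need not be differentiated.\<close>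

lemma eta_sum: "\<eta>\<^sub>1 e + \<eta>\<^sub>2 e + e = 4 * c"
  by (simp add: eta1_def eta2_def field_simps)

text \<open>Each end of the range is a threshold: e < alpha1 yields (e - 2c)^2 < 16 \<omega>, the
  sign condition for eta1 < 0 < eta2, and alpha0 < e yields eta2 < e.\<close>

lemma Apoly_bounds:
  assumes "e \<in> eta3_range"
  shows "0 < e" "(e - 4 * c)\<^sup>2 < Apoly \<omega> c e" "Apoly \<omega> c e < (3 * e - 4 * c)\<^sup>2" "4 * c < 3 * e"
proof -
  show e: "0 < e" "4 * c < 3 * e" using assms alpha0_nonneg alpha0_ge by auto
  have "\<bar>e - 2 * c\<bar> < 4 * sqrt \<omega>"
    using assms e c_le by (auto simp: alpha1_def abs_less_iff)
  then have "\<bar>e - 2 * c\<bar>\<^sup>2 < (4 * sqrt \<omega>)\<^sup>2"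
    by (intro power_strict_mono) auto
  then have "(e - 2 * c)\<^sup>2 < 16 * \<omega>" using omega_pos by (simp add: power_mult_distrib)
  then show "(e - 4 * c)\<^sup>2 < Apoly \<omega> c e"
    by (simp add: Apoly_def power2_eq_square algebra_simps)
  have "sqrt (48 * \<omega> + 4 * c\<^sup>2) < 3 * e - 4 * c" using assms by (auto simp: alpha0_def)
  then have "(sqrt (48 * \<omega> + 4 * c\<^sup>2))\<^sup>2 < (3 * e - 4 * c)\<^sup>2"
    using omega_pos by (intro power_strict_mono) auto
  then have "48 * \<omega> + 4 * c\<^sup>2 < (3 * e - 4 * c)\<^sup>2" using omega_pos by simp
  then show "Apoly \<omega> c e < (3 * e - 4 * c)\<^sup>2"
    by (simp add: Apoly_def power2_eq_square algebra_simps)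
qed

lemma eta_order:
  assumes "e \<in> eta3_range"
  shows "\<eta>\<^sub>1 e < 0" "0 < \<eta>\<^sub>2 e" "\<eta>\<^sub>2 e < e"
proof -
  note b = Apoly_bounds[OF assms]
  have "sqrt ((e - 4 * c)\<^sup>2) < sqrt (Apoly \<omega> c e)" using b(2) by (intro real_sqrt_less_mono)
  then show "\<eta>\<^sub>1 e < 0" "0 < \<eta>\<^sub>2 e" by (auto simp: eta1_def eta2_def)
  have "sqrt (Apoly \<omega> c e) < 3 * e - 4 * c" using b(3,4) by (intro real_less_lsqrt) auto
  then show "\<eta>\<^sub>2 e < e" by (simp add: eta2_def)
qed

lemma eta_pair_sum:
  assumes "e \<in> eta3_range"
  shows "\<eta>\<^sub>1 e * \<eta>\<^sub>2 e + \<eta>\<^sub>1 e * e + \<eta>\<^sub>2 e * e = 4 * c\<^sup>2 - 16 * \<omega>"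
proof -
  have "0 \<le> Apoly \<omega> c e" using Apoly_bounds(2)[OF assms] zero_le_power2[of "e - 4 * c"] by linarith
  then have "(sqrt (Apoly \<omega> c e))\<^sup>2 = -3*e\<^sup>2 + 8*c*e + 64*\<omega>" by (simp add: Apoly_def)
  then show ?thesis
    unfolding eta1_def eta2_def by (simp add: power2_eq_square field_simps)
qed

text \<open>Eliminate eta2 by the sum relation and subtract the pair relations at e and e'. The
  result factors, and every factor other than the increment of eta1 is known to be positive.\<close>

lemma eta1_strict_mono:
  assumes "e \<in> eta3_range" "e' \<in> eta3_range" "e < e'"
  shows "\<eta>\<^sub>1 e < \<eta>\<^sub>1 e'"
proof -
  have e2: "\<eta>\<^sub>2 x = 4 * c - x - \<eta>\<^sub>1 x" for x using eta_sum[of x] by simp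
  have "(e' - e) * (e' - \<eta>\<^sub>2 e) = (\<eta>\<^sub>1 e' - \<eta>\<^sub>1 e) * (\<eta>\<^sub>2 e' - \<eta>\<^sub>1 e)"
    using eta_pair_sum[OF assms(1)] eta_pair_sum[OF assms(2)] unfolding e2
    by (simp add: algebra_simps)
  moreover have "0 < (e' - e) * (e' - \<eta>\<^sub>2 e)" using eta_order[OF assms(1)] assms(3) by simp
  moreover have "0 < \<eta>\<^sub>2 e' - \<eta>\<^sub>1 e" using eta_order[OF assms(1)] eta_order[OF assms(2)] by simp
  ultimately show ?thesis by (simp add: zero_less_mult_iff)
qed

lemma eta2_strict_antimono:
  assumes "e \<in> eta3_range" "e' \<in> eta3_range" "e < e'"
  shows "\<eta>\<^sub>2 e' < \<eta>\<^sub>2 e"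
  using eta1_strict_mono[OF assms] eta_sum[of e] eta_sum[of e'] assms(3) by simp

text \<open>With these coefficients T = 8 agm_integral p q, which removes the modulus from the period.\<close>

definition "pcoef e = e * (\<eta>\<^sub>2 e - \<eta>\<^sub>1 e)"
definition "qcoef e = \<eta>\<^sub>2 e * (e - \<eta>\<^sub>1 e)"

lemma qcoef_bounds:
  assumes "e \<in> eta3_range"
  shows "0 < qcoef e" "qcoef e < pcoef e" "0 < pcoef e"
proof -
  note o = eta_order[OF assms]
  show q: "0 < qcoef e" unfolding qcoef_def using o by (intro mult_pos_pos) auto
  have "0 < - \<eta>\<^sub>1 e * (e - \<eta>\<^sub>2 e)" using o by (intro mult_pos_pos) auto
  then show "qcoef e < pcoef e" by (simp add: qcoef_def pcoef_def algebra_simps)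
  with q show "0 < pcoef e" by simp
qed

text \<open>By Vieta the product depends on eta1 alone. Its decrement is the increment of eta1 times
  4c - eta1 e - eta1 e' = eta2 e + e - eta1 e' > 0.\<close>

lemma eta2_mult_strict_antimono:
  assumes "e \<in> eta3_range" "e' \<in> eta3_range" "e < e'"
  shows "\<eta>\<^sub>2 e' * e' < \<eta>\<^sub>2 e * e"
proof -
  have eq: "\<eta>\<^sub>2 x * x = 4 * c\<^sup>2 - 16 * \<omega> - \<eta>\<^sub>1 x * (4 * c - \<eta>\<^sub>1 x)" if "x \<in> eta3_range" for x
  proof -
    have "4 * c - \<eta>\<^sub>1 x = \<eta>\<^sub>2 x + x" using eta_sum[of x] by simp
    then show ?thesis using eta_pair_sum[OF that] by (simp add: algebra_simps)
  qed
  have "0 < (\<eta>\<^sub>1 e' - \<eta>\<^sub>1 e) * (4 * c - \<eta>\<^sub>1 e - \<eta>\<^sub>1 e')"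
    using eta1_strict_mono[OF assms] eta_order[OF assms(1)] eta_order[OF assms(2)] eta_sum[of e]
    by (intro mult_pos_pos) auto
  then show ?thesis unfolding eq[OF assms(1)] eq[OF assms(2)] by (simp add: algebra_simps)
qed

lemma qcoef_strict_antimono:
  assumes "e \<in> eta3_range" "e' \<in> eta3_range" "e < e'"
  shows "qcoef e' < qcoef e"
proof -
  have "- \<eta>\<^sub>1 e' * \<eta>\<^sub>2 e' < - \<eta>\<^sub>1 e * \<eta>\<^sub>2 e"
    using eta1_strict_mono[OF assms] eta2_strict_antimono[OF assms] eta_order[OF assms(1)] eta_order[OF assms(2)]
    by (intro mult_strict_mono) auto
  then show ?thesis using eta2_mult_strict_antimono[OF assms] by (simp add: qcoef_def algebra_simps)
qed

lemma pcoef_add_qcoef_strict_antimono: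
  assumes "e \<in> eta3_range" "e' \<in> eta3_range" "e < e'"
  shows "pcoef e' + qcoef e' < pcoef e + qcoef e"
proof -
  have "pcoef x + qcoef x = 3 * (\<eta>\<^sub>2 x * x) - (4 * c\<^sup>2 - 16 * \<omega>)" if "x \<in> eta3_range" for x
    using eta_pair_sum[OF that] by (simp add: pcoef_def qcoef_def algebra_simps)
  then show ?thesis using eta2_mult_strict_antimono[OF assms] assms by simp
qed

lemma ksq_eq: "ksq \<omega> c e = (pcoef e - qcoef e) / pcoef e"
proof -
  have "pcoef e - qcoef e = - \<eta>\<^sub>1 e * (e - \<eta>\<^sub>2 e)"
    by (simp add: pcoef_def qcoef_def algebra_simps)
  then show ?thesis by (simp only: ksq_def pcoef_def)
qed

lemma ksq_bounds:
  assumes "e \<in> eta3_range"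
  shows "0 < ksq \<omega> c e" "ksq \<omega> c e < 1"
  unfolding ksq_eq using qcoef_bounds[OF assms] by auto

lemma Tper_eq_agm_integral:
  assumes "e \<in> eta3_range"
  shows "Tper \<omega> c e = 8 * agm_integral (pcoef e) (qcoef e)"
proof -
  note q = qcoef_bounds[OF assms]
  have g: "gfun \<omega> c e = 2 / sqrt (pcoef e)" by (simp add: gfun_def pcoef_def)
  have eq: "pcoef e * (1 - ksq \<omega> c e * (sin t)\<^sup>2) = pcoef e * (cos t)\<^sup>2 + qcoef e * (sin t)\<^sup>2" for t
    using q unfolding ksq_eq cos_squared_eq by (simp add: field_simps)
  have "1 / sqrt (pcoef e * (cos t)\<^sup>2 + qcoef e * (sin t)\<^sup>2)
      = 1 / sqrt (pcoef e) * (1 / sqrt (1 - ksq \<omega> c e * (sin t)\<^sup>2))" for t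
    unfolding eq[symmetric] real_sqrt_mult by simp
  then show ?thesis
    unfolding Tper_def g ellK_def agm_integral_def by (simp only: integral_mult_right)
qed

lemma Tper_strict_mono:
  assumes "e \<in> eta3_range" "e' \<in> eta3_range" "e < e'"
  shows "Tper \<omega> c e < Tper \<omega> c e'"
  unfolding Tper_eq_agm_integral[OF assms(1)] Tper_eq_agm_integral[OF assms(2)]
  using qcoef_strict_antimono[OF assms] pcoef_add_qcoef_strict_antimono[OF assms]
    qcoef_bounds[OF assms(1)] qcoef_bounds[OF assms(2)]
  by (auto intro!: agm_integral_less)

section \<open>Continuity and divergence of the period\<close>

lemma continuous_on_coefs: "continuous_on S pcoef" "continuous_on S qcoef"
  unfolding eta1_def eta2_def pcoef_def qcoef_def Apoly_def by (intro continuous_intros; simp)+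

lemma continuous_on_Tper: "continuous_on eta3_range (Tper \<omega> c)"
proof -
  have "continuous_on eta3_range (\<lambda>e. 8 * agm_integral (pcoef e) (qcoef e))"
    by (intro continuous_on_mult continuous_on_const continuous_on_agm_integral continuous_on_coefs)
       (use qcoef_bounds in auto)
  then show ?thesis by (rule continuous_on_eq) (simp add: Tper_eq_agm_integral)
qed

text \<open>At the right end A is a perfect square. Hence \<open>qcoef\<close> vanishes there, which
  forces the period to diverge in both admissible cases.\<close>

lemma eta2_alpha1: "\<eta>\<^sub>2 (alpha1 \<omega> c) = 0"
proof -
  define w where "w = sqrt \<omega>"
  have w: "0 < w" "\<omega> = w\<^sup>2" using omega_pos by (auto simp: w_def)
  have "Apoly \<omega> c (alpha1 \<omega> c) = (4 * w - 2 * c)\<^sup>2"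
    unfolding Apoly_def alpha1_def w_def[symmetric] by (simp add: w(2) power2_eq_square algebra_simps)
  then have "sqrt (Apoly \<omega> c (alpha1 \<omega> c)) = 4 * w - 2 * c" using c_le by (simp add: w_def)
  then show ?thesis by (simp add: eta2_def alpha1_def w_def)
qed

lemma Tper_unbounded:
  assumes "e0 \<in> eta3_range"
  shows "\<exists>e \<in> eta3_range. e0 < e \<and> N \<le> Tper \<omega> c e"
proof -
  \<comment> \<open>\<open>pcoef + qcoef\<close> decreases, so its value at \<open>e0\<close> bounds
    \<open>pcoef\<close> from above at every later point.\<close>
  define P where "P = pcoef e0 + qcoef e0"
  have P: "0 < P" using qcoef_bounds[OF assms] by (simp add: P_def)
  \<comment> \<open>Solves (ln (pi/2) - ln d) / sqrt P = N / 8; the 8 is the factor between the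
    period and \<open>agm_integral\<close>.\<close>
  define d where "d = exp (ln (pi/2) - N / 8 * sqrt P)"
  have d: "0 < d" by (simp add: d_def)
  have "isCont qcoef (alpha1 \<omega> c)"
    using continuous_on_coefs(2)[of UNIV] by (simp add: continuous_on_eq_continuous_at)
  then have "(qcoef \<longlongrightarrow> 0) (at_left (alpha1 \<omega> c))"
    using eta2_alpha1 by (auto simp: isCont_def qcoef_def intro: tendsto_within_subset)
  then have "\<forall>\<^sub>F e in at_left (alpha1 \<omega> c). qcoef e < P * d\<^sup>2"
    by (rule order_tendstoD) (use P d in simp)
  moreover have "\<forall>\<^sub>F e in at_left (alpha1 \<omega> c). e \<in> {e0<..<alpha1 \<omega> c}"
    using assms by (intro eventually_at_leftI[of e0]) auto
  ultimately have "\<forall>\<^sub>F e in at_left (alpha1 \<omega> c). qcoef e < P * d\<^sup>2 \<and> e \<in> {e0<..<alpha1 \<omega> c}"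
    by (rule eventually_conj)
  then obtain e where e: "qcoef e < P * d\<^sup>2" "e0 < e" "e < alpha1 \<omega> c"
    using eventually_happens'[OF trivial_limit_at_left_real] by auto
  have r: "e \<in> eta3_range" using e assms by auto
  have "N / 8 = (ln (pi/2) - ln d) / sqrt P" using P by (simp add: d_def)
  also have "\<dots> \<le> (ln (pi/2 + d) - ln d) / sqrt P"
    using d P by (intro divide_right_mono diff_right_mono) (auto intro!: ln_mono)
  also have "\<dots> \<le> agm_integral (pcoef e) (qcoef e)"
    using qcoef_bounds[OF r] pcoef_add_qcoef_strict_antimono[OF assms r e(2)] e(1) d
    by (intro agm_integral_ge_ln) (auto simp: P_def)
  finally have "N \<le> Tper \<omega> c e" by (simp add: Tper_eq_agm_integral[OF r])
  then show ?thesis using r e(2) by blast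
qed

text \<open>The intermediate value theorem gives existence and strict monotonicity uniqueness, so
  the definite description denotes the solution. The lower bound \<open>e0\<close>, which may lie
  arbitrarily close to alpha1, is the source of the limit in \<open>eta3L_tendsto\<close>.\<close>

lemma eta3L_spec:
  assumes e0: "e0 \<in> eta3_range" and L: "Tper \<omega> c e0 < 2 * L"
  shows "e0 < eta3L \<omega> c L" "eta3L \<omega> c L \<in> eta3_range" "Tper \<omega> c (eta3L \<omega> c L) = 2 * L"
proof -
  obtain e1 where e1: "e1 \<in> eta3_range" "e0 < e1" "2 * L \<le> Tper \<omega> c e1"
    using Tper_unbounded[OF e0] by blast
  have "continuous_on {e0..e1} (Tper \<omega> c)"
    by (rule continuous_on_subset[OF continuous_on_Tper]) (use e0 e1 in auto)
  then obtain e where e: "e0 \<le> e" "e \<le> e1" "Tper \<omega> c e = 2 * L"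
    using IVT'[of "Tper \<omega> c" e0 "2 * L" e1] L e1 by auto
  have er: "e \<in> eta3_range" using e e0 e1 by auto
  have "eta3L \<omega> c L = e"
    unfolding eta3L_def
  proof (rule the_equality)
    fix x assume x: "alpha0 \<omega> c < x \<and> x < alpha1 \<omega> c \<and> Tper \<omega> c x = 2 * L"
    then show "x = e" using Tper_strict_mono[OF er, of x] Tper_strict_mono[OF _ er, of x] e(3)
      by (cases x e rule: linorder_cases) auto
  qed (use er e in auto)
  then show "e0 < eta3L \<omega> c L" "eta3L \<omega> c L \<in> eta3_range" "Tper \<omega> c (eta3L \<omega> c L) = 2 * L"
    using e er L by (auto simp: order_le_less)
qed

lemma eventually_eta3L:
  assumes "e0 \<in> eta3_range"
  shows "\<forall>\<^sub>F L in at_top. e0 < eta3L \<omega> c L \<and> eta3L \<omega> c L \<in> eta3_range \<and> Tper \<omega> c (eta3L \<omega> c L) = 2 * L"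
  using eventually_gt_at_top[of "Tper \<omega> c e0 / 2"]
  by eventually_elim (use eta3L_spec[OF assms] in auto)

lemma eta3L_tendsto: "(eta3L \<omega> c \<longlongrightarrow> alpha1 \<omega> c) at_top"
proof (rule order_tendstoI)
  fix a assume a: "a < alpha1 \<omega> c"
  define e0 where "e0 = (max a (alpha0 \<omega> c) + alpha1 \<omega> c) / 2"
  have e0: "e0 \<in> eta3_range" "a \<le> e0" using a alpha0_less_alpha1 by (auto simp: e0_def)
  show "\<forall>\<^sub>F L in at_top. a < eta3L \<omega> c L"
    using eventually_eta3L[OF e0(1)] by eventually_elim (use e0 in auto)
next
  fix a assume a: "alpha1 \<omega> c < a"
  have "(alpha0 \<omega> c + alpha1 \<omega> c) / 2 \<in> eta3_range" using alpha0_less_alpha1 by auto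
  from eventually_eta3L[OF this] show "\<forall>\<^sub>F L in at_top. eta3L \<omega> c L < a"
    by eventually_elim (use a in auto)
qed

end

subsection \<open>The profile equation\<close>

text \<open>Polynomials in (u, u') without constant term. The force is one of them, hence so is every
  higher derivative of a solution of u'' = force u; vanishing at the origin is what makes the
  decay of u and u' carry over to all derivatives.\<close>

inductive_set jet_polys :: "(real \<Rightarrow> real \<Rightarrow> real) set" where
  proj1: "(\<lambda>a b. a) \<in> jet_polys"
| proj2: "(\<lambda>a b. b) \<in> jet_polys"
| scale: "G \<in> jet_polys \<Longrightarrow> (\<lambda>a b. r * G a b) \<in> jet_polys"
| add: "G \<in> jet_polys \<Longrightarrow> H \<in> jet_polys \<Longrightarrow> (\<lambda>a b. G a b + H a b) \<in> jet_polys"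
| mult: "G \<in> jet_polys \<Longrightarrow> H \<in> jet_polys \<Longrightarrow> (\<lambda>a b. G a b * H a b) \<in> jet_polys"

section \<open>Lipschitz, Gronwall and domination estimates\<close>

lemma jet_polys_zero: "G \<in> jet_polys \<Longrightarrow> G 0 0 = 0"
  by (induction rule: jet_polys.induct) auto

text \<open>Products need bounds on the factors themselves. The bound \<open>K * (2 * M)\<close>
  comes from the Lipschitz estimate against the origin, where every member vanishes.\<close>

lemma jet_polys_Lipschitz:
  assumes "G \<in> jet_polys" "0 \<le> M"
  shows "\<exists>K\<ge>0. \<forall>a b a' b'. \<bar>a\<bar> \<le> M \<longrightarrow> \<bar>b\<bar> \<le> M \<longrightarrow> \<bar>a'\<bar> \<le> M \<longrightarrow> \<bar>b'\<bar> \<le> M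
           \<longrightarrow> \<bar>G a b - G a' b'\<bar> \<le> K * (\<bar>a - a'\<bar> + \<bar>b - b'\<bar>)"
  using assms(1)
proof (induction rule: jet_polys.induct)
  case proj1
  then show ?case by (intro exI[of _ 1]) auto
next
  case proj2
  then show ?case by (intro exI[of _ 1]) auto
next
  case (scale G r)
  then obtain K where K: "K \<ge> 0" "\<And>a b a' b'. \<bar>a\<bar> \<le> M \<Longrightarrow> \<bar>b\<bar> \<le> M \<Longrightarrow> \<bar>a'\<bar> \<le> M \<Longrightarrow> \<bar>b'\<bar> \<le> M
       \<Longrightarrow> \<bar>G a b - G a' b'\<bar> \<le> K * (\<bar>a - a'\<bar> + \<bar>b - b'\<bar>)" by blast
  show ?case
  proof (intro exI[of _ "\<bar>r\<bar> * K"] conjI allI impI)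
    fix a b a' b' assume "\<bar>a\<bar> \<le> M" "\<bar>b\<bar> \<le> M" "\<bar>a'\<bar> \<le> M" "\<bar>b'\<bar> \<le> M"
    then have "\<bar>r\<bar> * \<bar>G a b - G a' b'\<bar> \<le> \<bar>r\<bar> * (K * (\<bar>a - a'\<bar> + \<bar>b - b'\<bar>))"
      by (intro mult_left_mono K) auto
    then show "\<bar>r * G a b - r * G a' b'\<bar> \<le> \<bar>r\<bar> * K * (\<bar>a - a'\<bar> + \<bar>b - b'\<bar>)"
      by (simp add: abs_mult mult.assoc flip: right_diff_distrib)
  qed (use K in simp)
next
  case (add G H)
  then obtain K K' where K: "K \<ge> 0" "\<And>a b a' b'. \<bar>a\<bar> \<le> M \<Longrightarrow> \<bar>b\<bar> \<le> M \<Longrightarrow> \<bar>a'\<bar> \<le> M \<Longrightarrow> \<bar>b'\<bar> \<le> M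
       \<Longrightarrow> \<bar>G a b - G a' b'\<bar> \<le> K * (\<bar>a - a'\<bar> + \<bar>b - b'\<bar>)"
    and K': "K' \<ge> 0" "\<And>a b a' b'. \<bar>a\<bar> \<le> M \<Longrightarrow> \<bar>b\<bar> \<le> M \<Longrightarrow> \<bar>a'\<bar> \<le> M \<Longrightarrow> \<bar>b'\<bar> \<le> M
       \<Longrightarrow> \<bar>H a b - H a' b'\<bar> \<le> K' * (\<bar>a - a'\<bar> + \<bar>b - b'\<bar>)" by blast
  show ?case
  proof (intro exI[of _ "K + K'"] conjI allI impI)
    fix a b a' b' assume "\<bar>a\<bar> \<le> M" "\<bar>b\<bar> \<le> M" "\<bar>a'\<bar> \<le> M" "\<bar>b'\<bar> \<le> M"
    from K(2)[OF this] K'(2)[OF this]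
    show "\<bar>G a b + H a b - (G a' b' + H a' b')\<bar> \<le> (K + K') * (\<bar>a - a'\<bar> + \<bar>b - b'\<bar>)"
      unfolding distrib_right by linarith
  qed (use K K' in simp)
next
  case (mult G H)
  then obtain K K' where K: "K \<ge> 0" "\<And>a b a' b'. \<bar>a\<bar> \<le> M \<Longrightarrow> \<bar>b\<bar> \<le> M \<Longrightarrow> \<bar>a'\<bar> \<le> M \<Longrightarrow> \<bar>b'\<bar> \<le> M
       \<Longrightarrow> \<bar>G a b - G a' b'\<bar> \<le> K * (\<bar>a - a'\<bar> + \<bar>b - b'\<bar>)"
    and K': "K' \<ge> 0" "\<And>a b a' b'. \<bar>a\<bar> \<le> M \<Longrightarrow> \<bar>b\<bar> \<le> M \<Longrightarrow> \<bar>a'\<bar> \<le> M \<Longrightarrow> \<bar>b'\<bar> \<le> M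
       \<Longrightarrow> \<bar>H a b - H a' b'\<bar> \<le> K' * (\<bar>a - a'\<bar> + \<bar>b - b'\<bar>)" by blast
  show ?case
  proof (intro exI[of _ "K * (2 * M) * K' + K' * (2 * M) * K"] conjI allI impI)
    fix a b a' b' assume ab: "\<bar>a\<bar> \<le> M" "\<bar>b\<bar> \<le> M" "\<bar>a'\<bar> \<le> M" "\<bar>b'\<bar> \<le> M"
    let ?d = "\<bar>a - a'\<bar> + \<bar>b - b'\<bar>"
    have "\<bar>G a b\<bar> \<le> K * (\<bar>a\<bar> + \<bar>b\<bar>)"
      using K(2)[of a b 0 0] ab jet_polys_zero[OF mult.hyps(1)] \<open>0 \<le> M\<close> by simp
    also have "\<dots> \<le> K * (2 * M)" using ab K(1) by (intro mult_left_mono) auto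
    finally have G: "\<bar>G a b\<bar> \<le> K * (2 * M)" .
    have "\<bar>H a' b'\<bar> \<le> K' * (\<bar>a'\<bar> + \<bar>b'\<bar>)"
      using K'(2)[of a' b' 0 0] ab jet_polys_zero[OF mult.hyps(2)] \<open>0 \<le> M\<close> by simp
    also have "\<dots> \<le> K' * (2 * M)" using ab K'(1) by (intro mult_left_mono) auto
    finally have H: "\<bar>H a' b'\<bar> \<le> K' * (2 * M)" .
    have "G a b * H a b - G a' b' * H a' b' = G a b * (H a b - H a' b') + H a' b' * (G a b - G a' b')"
      by (simp add: algebra_simps)
    also have "\<bar>\<dots>\<bar> \<le> \<bar>G a b\<bar> * \<bar>H a b - H a' b'\<bar> + \<bar>H a' b'\<bar> * \<bar>G a b - G a' b'\<bar>"
      by (metis abs_mult abs_triangle_ineq)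
    also have "\<dots> \<le> K * (2 * M) * (K' * ?d) + K' * (2 * M) * (K * ?d)"
      using K(1) K'(1) K(2)[OF ab] K'(2)[OF ab] G H \<open>0 \<le> M\<close> by (intro add_mono mult_mono) auto
    finally show "\<bar>G a b * H a b - G a' b' * H a' b'\<bar> \<le> (K * (2 * M) * K' + K' * (2 * M) * K) * ?d"
      by (simp add: algebra_simps)
  qed (use K K' \<open>0 \<le> M\<close> in simp)
qed

text \<open>Gronwall's inequality in both directions, with the integrating factor
  \<open>exp (- K * x)\<close> to the right of 0 and \<open>exp (K * x)\<close> to the left.\<close>

lemma abs_deriv_le_imp_exp_bound:
  fixes N N' :: "real \<Rightarrow> real"
  assumes der: "\<And>x. (N has_real_derivative N' x) (at x)" and le: "\<And>x. \<bar>N' x\<bar> \<le> K * N x"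
  shows "N x \<le> N 0 * exp (K * \<bar>x\<bar>)"
proof (cases "0 \<le> x")
  case True
  have "N x * exp (- K * x) \<le> N 0 * exp (- K * 0)"
  proof (rule DERIV_nonpos_imp_nonincreasing[OF True])
    fix t
    have "((\<lambda>x. N x * exp (- K * x)) has_real_derivative (N' t - K * N t) * exp (- K * t)) (at t)"
      by (auto intro!: derivative_eq_intros der simp: algebra_simps)
    moreover have "(N' t - K * N t) * exp (- K * t) \<le> 0"
      using le[of t] by (intro mult_nonpos_nonneg) auto
    ultimately show "\<exists>y. ((\<lambda>x. N x * exp (- K * x)) has_real_derivative y) (at t) \<and> y \<le> 0" by blast
  qed
  then show ?thesis using True by (simp add: exp_minus field_simps)
next
  case False
  then have x: "x \<le> 0" by simp
  have "N x * exp (K * x) \<le> N 0 * exp (K * 0)"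
  proof (rule DERIV_nonneg_imp_nondecreasing[OF x])
    fix t
    have "((\<lambda>x. N x * exp (K * x)) has_real_derivative (N' t + K * N t) * exp (K * t)) (at t)"
      by (auto intro!: derivative_eq_intros der simp: algebra_simps)
    moreover have "0 \<le> (N' t + K * N t) * exp (K * t)"
      using le[of t] by (intro mult_nonneg_nonneg) auto
    ultimately show "\<exists>y. ((\<lambda>x. N x * exp (K * x)) has_real_derivative y) (at t) \<and> 0 \<le> y" by blast
  qed
  then show ?thesis using False by (simp add: exp_minus field_simps)
qed

text \<open>Dominated convergence over growing intervals. B arctan x is an antiderivative of the
  dominating function, so R can be chosen with each tail below \<epsilon>/8 for all large L; on
  [-R, R] the local bound \<epsilon>/(8R) contributes \<epsilon>/4.\<close>

lemma tendsto_integral_sq_zero: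
  fixes h :: "real \<Rightarrow> real \<Rightarrow> real"
  assumes cont: "\<forall>\<^sub>F L in at_top. continuous_on UNIV (h L)"
    and dom: "\<forall>\<^sub>F L in at_top. \<forall>x. \<bar>x\<bar> \<le> L \<longrightarrow> (h L x)\<^sup>2 \<le> B / (1 + x\<^sup>2)"
    and loc: "\<And>R \<epsilon>. 0 < R \<Longrightarrow> 0 < \<epsilon> \<Longrightarrow> \<forall>\<^sub>F L in at_top. \<forall>x. \<bar>x\<bar> \<le> R \<longrightarrow> (h L x)\<^sup>2 \<le> \<epsilon>"
  shows "((\<lambda>L. integral {-L..L} (\<lambda>x. (h L x)\<^sup>2)) \<longlongrightarrow> 0) at_top"
proof (rule tendstoI)
  fix \<epsilon> :: real assume \<epsilon>: "0 < \<epsilon>"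
  have "((\<lambda>R. B * (pi/2 - arctan R)) \<longlongrightarrow> B * (pi/2 - pi/2)) at_top"
    by (intro tendsto_intros tendsto_arctan_at_top)
  then have "\<forall>\<^sub>F R in at_top. B * (pi/2 - arctan R) < \<epsilon> / 8"
    using \<epsilon> by (intro order_tendstoD) auto
  then have "\<forall>\<^sub>F R in at_top. B * (pi/2 - arctan R) < \<epsilon> / 8 \<and> 0 < R"
    using eventually_gt_at_top by (rule eventually_conj)
  then obtain R where R: "B * (pi/2 - arctan R) < \<epsilon> / 8" "0 < R"
    using eventually_happens'[OF trivial_limit_at_top_linorder] by auto
  have "\<forall>\<^sub>F L in at_top. \<forall>x. \<bar>x\<bar> \<le> R \<longrightarrow> (h L x)\<^sup>2 \<le> \<epsilon> / (8 * R)"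
    using R \<epsilon> by (intro loc) auto
  with cont dom eventually_gt_at_top[of R]
  show "\<forall>\<^sub>F L in at_top. dist (integral {-L..L} (\<lambda>x. (h L x)\<^sup>2)) 0 < \<epsilon>"
  proof eventually_elim
    case (elim L)
    let ?H = "\<lambda>x. (h L x)\<^sup>2"
    have int: "?H integrable_on {a..b}" for a b
      by (intro integrable_continuous_interval continuous_intros continuous_on_subset[OF elim(1)]) auto
    have B: "0 \<le> B" using order_trans[OF zero_le_power2 elim(2)[rule_format, of 0]] elim(3) R(2) by simp
    have tail: "integral {a..b} ?H \<le> B * (arctan b - arctan a)" if "a \<le> b" "-L \<le> a" "b \<le> L" for a b
    proof (rule has_integral_le[OF integrable_integral[OF int]])
      have "((\<lambda>x. B / (1 + x\<^sup>2)) has_integral B * arctan b - B * arctan a) {a..b}"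
        using \<open>a \<le> b\<close>
      proof (rule fundamental_theorem_of_calculus)
        fix x
        show "((\<lambda>x. B * arctan x) has_vector_derivative B / (1 + x\<^sup>2)) (at x within {a..b})"
          unfolding has_real_derivative_iff_has_vector_derivative[symmetric]
          by (auto intro!: derivative_eq_intros simp: field_simps)
      qed
      then show "((\<lambda>x. B / (1 + x\<^sup>2)) has_integral B * (arctan b - arctan a)) {a..b}"
        by (simp add: right_diff_distrib)
    qed (use elim(2) that in auto)
    have "integral {-R..R} ?H \<le> integral {-R..R} (\<lambda>_. \<epsilon> / (8 * R))"
      by (intro integral_le int) (use elim(4) in auto)
    also have "\<dots> = \<epsilon> / 4" using R by (simp add: field_simps)
    finally have mid: "integral {-R..R} ?H \<le> \<epsilon> / 4" .
    have "B * arctan L \<le> B * (pi/2)"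
      using B arctan_ubound[of L] by (intro mult_left_mono) auto
    then have "integral {R..L} ?H < \<epsilon> / 8" "integral {-L..-R} ?H < \<epsilon> / 8"
      using tail[of R L] tail[of "-L" "-R"] R elim(3) by (auto simp: algebra_simps arctan_minus)
    moreover have "integral {-L..L} ?H = integral {-L..-R} ?H + integral {-R..R} ?H + integral {R..L} ?H"
      using Henstock_Kurzweil_Integration.integral_combine[of "-L" R L ?H, OF _ _ int]
        Henstock_Kurzweil_Integration.integral_combine[of "-L" "-R" R ?H, OF _ _ int] R elim(3) by auto
    moreover have "0 \<le> integral {-L..L} ?H"
      by (intro Henstock_Kurzweil_Integration.integral_nonneg int) auto
    ultimately show ?case using mid \<epsilon> by (simp add: dist_real_def)
  qed
qed

section \<open>First integral and higher derivatives of profiles\<close>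

context wave_parameters
begin

definition "force u = (\<omega> - c\<^sup>2 / 4) * u + c / 2 * u ^ 3 - 3 / 16 * u ^ 5"
text \<open>Twice the antiderivative of \<open>force\<close> that vanishes at 0, so that v^2 -
  potential u is conserved.\<close>

definition "potential u = (\<omega> - c\<^sup>2 / 4) * u\<^sup>2 + c / 4 * u ^ 4 - u ^ 6 / 16"

text \<open>The equation as a system in the phase plane; \<open>v 0 = 0\<close> leaves the amplitude
  \<open>u 0\<close> as the only parameter.\<close>

definition profile :: "(real \<Rightarrow> real) \<Rightarrow> (real \<Rightarrow> real) \<Rightarrow> bool" where
  "profile u v \<longleftrightarrow> (\<forall>x. (u has_real_derivative v x) (at x)) \<and>
     (\<forall>x. (v has_real_derivative force (u x)) (at x)) \<and> v 0 = 0"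

lemma profileD:
  assumes "profile u v"
  shows "(u has_real_derivative v x) (at x)" "(v has_real_derivative force (u x)) (at x)" "v 0 = 0"
  using assms by (auto simp: profile_def)

text \<open>In terms of w = 1 / u^2 the first integral becomes a cubic, with E the energy constant
  (E = 0 for the solitary wave, 16 E = eta1 eta2 eta3 for the periodic one).\<close>

lemma profile_inverse_sqrt:
  assumes pos: "\<And>x. 0 < w x"
    and der: "\<And>x. (w has_real_derivative w1 x) (at x)"
      "\<And>x. (w1 has_real_derivative c / 2 + (4 * \<omega> - c\<^sup>2) * w x + 6 * E * (w x)\<^sup>2) (at x)"
    and first: "\<And>x. (w1 x)\<^sup>2 = (- 1 + 4 * c * w x + (16 * \<omega> - 4 * c\<^sup>2) * (w x)\<^sup>2 + 16 * E * (w x) ^ 3) / 4"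
    and "w1 0 = 0"
  shows "profile (\<lambda>x. 1 / sqrt (w x)) (\<lambda>x. - w1 x / (2 * sqrt (w x) ^ 3))"
  unfolding profile_def
proof (intro conjI allI)
  fix x
  define r where "r = sqrt (w x)"
  have r: "0 < r" "w x = r\<^sup>2" using pos[of x] by (auto simp: r_def)
  have dr: "((\<lambda>x. sqrt (w x)) has_real_derivative w1 x / (2 * r)) (at x)"
    using pos[of x] by (auto intro!: derivative_eq_intros der simp: r_def field_simps)
  show "((\<lambda>x. 1 / sqrt (w x)) has_real_derivative - w1 x / (2 * sqrt (w x) ^ 3)) (at x)"
    unfolding r_def[symmetric]
    by (rule DERIV_cong[OF DERIV_divide[OF DERIV_const dr]])
       (use r(1) in \<open>auto simp: power3_eq_cube r_def[symmetric]\<close>)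
  let ?w2 = "c / 2 + (4 * \<omega> - c\<^sup>2) * w x + 6 * E * (w x)\<^sup>2"
  have "((\<lambda>x. - w1 x / (2 * sqrt (w x) ^ 3)) has_real_derivative
      (- ?w2 * (2 * r ^ 3) - (- w1 x) * (2 * (3 * (w1 x / (2 * r)) * r ^ 2))) / ((2 * r ^ 3) * (2 * r ^ 3))) (at x)"
    by (rule DERIV_cong[OF DERIV_divide[OF DERIV_minus[OF der(2)[of x]] DERIV_cmult[OF DERIV_power[OF dr, of 3], of 2]]])
       (use r(1) in \<open>simp_all add: r_def[symmetric]\<close>)
  also have "(- ?w2 * (2 * r ^ 3) - (- w1 x) * (2 * (3 * (w1 x / (2 * r)) * r ^ 2))) / ((2 * r ^ 3) * (2 * r ^ 3))
      = - ?w2 / (2 * r ^ 3) + 3 * (w1 x)\<^sup>2 / (4 * r ^ 5)"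
    using r(1) by (simp add: field_simps power2_eq_square eval_nat_numeral)
  \<comment> \<open>The E-terms of w'' and of the first integral cancel here, so every energy level
    leads to the same force.\<close>
  also have "\<dots> = force (1 / r)"
    unfolding first r(2) force_def using r(1)
    by (simp add: field_simps eval_nat_numeral)
  finally show "((\<lambda>x. - w1 x / (2 * sqrt (w x) ^ 3)) has_real_derivative force (1 / sqrt (w x))) (at x)"
    by (simp add: r_def)
qed (use assms in simp)

lemma profile_energy:
  assumes "profile u v"
  shows "(v x)\<^sup>2 = potential (u x) - potential (u 0)"
proof -
  note d = profileD[OF assms]
  have "((\<lambda>x. (v x)\<^sup>2 - potential (u x)) has_real_derivative 0) (at x)" for x
    unfolding potential_def
    by (auto intro!: derivative_eq_intros d simp: force_def algebra_simps eval_nat_numeral)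
  then have "(v x)\<^sup>2 - potential (u x) = (v 0)\<^sup>2 - potential (u 0)"
    by (intro DERIV_isconst_all) blast
  then show ?thesis using d(3) by simp
qed

text \<open>The energy identity with its nonpositive constant dropped: \<open>potential u\<close> is
  u^2 times a factor whose negative terms may be discarded. The constant depends on M only, hence
  will not depend on L.\<close>

lemma profile_deriv_le:
  assumes "profile u v" "0 \<le> potential (u 0)" "(u x)\<^sup>2 \<le> M"
  shows "(v x)\<^sup>2 \<le> (\<omega> + \<bar>c\<bar> * M) * (u x)\<^sup>2"
proof -
  define y where "y = (u x)\<^sup>2"
  have y: "0 \<le> y" "y \<le> M" using assms by (auto simp: y_def)
  have "c * y \<le> \<bar>c\<bar> * M" using y by (intro mult_mono) auto
  then have "c * y / 4 \<le> \<bar>c\<bar> * M"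
    using y mult_nonneg_nonneg[of "\<bar>c\<bar>" M] by linarith
  then have "(\<omega> - c\<^sup>2 / 4) + c / 4 * y - y\<^sup>2 / 16 \<le> \<omega> + \<bar>c\<bar> * M"
    using zero_le_power2[of y] zero_le_power2[of c] unfolding times_divide_eq_left by linarith
  then have "y * ((\<omega> - c\<^sup>2 / 4) + c / 4 * y - y\<^sup>2 / 16) \<le> y * (\<omega> + \<bar>c\<bar> * M)"
    using y by (intro mult_left_mono)
  moreover have "potential (u x) = y * ((\<omega> - c\<^sup>2 / 4) + c / 4 * y - y\<^sup>2 / 16)"
    by (simp add: potential_def y_def algebra_simps eval_nat_numeral)
  ultimately show ?thesis using profile_energy[OF assms(1), of x] assms(2)
    by (simp add: y_def mult.commute)
qed

lemma force_jet_poly: "(\<lambda>a b. force a) \<in> jet_polys"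
proof -
  \<comment> \<open>Exponents start at 1, since nonzero constants are not in the class.\<close>
  have pow: "(\<lambda>a b. a ^ Suc n) \<in> jet_polys" for n
  proof (induction n)
    case (Suc n)
    from jet_polys.mult[OF jet_polys.proj1 this] show ?case by simp
  qed (simp add: jet_polys.proj1)
  have "(\<lambda>a b. ((\<omega> - c\<^sup>2 / 4) * a ^ Suc 0 + c / 2 * a ^ Suc 2) + (- 3 / 16) * a ^ Suc 4) \<in> jet_polys"
    by (intro jet_polys.add jet_polys.scale pow)
  then show ?thesis by (simp add: force_def)
qed

text \<open>Along a profile, differentiation replaces a by b and b by \<open>force a\<close>. G' is
  chosen before u and v, so one polynomial, with one Lipschitz constant, serves the waves for all
  L.\<close>

lemma jet_polys_deriv:
  assumes "G \<in> jet_polys"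
  shows "\<exists>G'\<in>jet_polys. \<forall>u v x. profile u v \<longrightarrow>
           ((\<lambda>x. G (u x) (v x)) has_real_derivative G' (u x) (v x)) (at x)"
  using assms
proof (induction rule: jet_polys.induct)
  case proj1
  then show ?case by (intro bexI[OF _ jet_polys.proj2]) (auto dest: profileD)
next
  case proj2
  then show ?case by (intro bexI[OF _ force_jet_poly]) (auto dest: profileD)
next
  case (scale G r)
  then obtain G' where G': "G' \<in> jet_polys" "\<And>u v x. profile u v \<Longrightarrow>
      ((\<lambda>x. G (u x) (v x)) has_real_derivative G' (u x) (v x)) (at x)" by blast
  show ?case
    by (intro bexI[OF _ jet_polys.scale[OF G'(1), of r]]) (auto intro!: DERIV_cmult G')
next
  case (add G H)
  then obtain G' H' where G': "G' \<in> jet_polys" "\<And>u v x. profile u v \<Longrightarrow>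
      ((\<lambda>x. G (u x) (v x)) has_real_derivative G' (u x) (v x)) (at x)"
    and H': "H' \<in> jet_polys" "\<And>u v x. profile u v \<Longrightarrow>
      ((\<lambda>x. H (u x) (v x)) has_real_derivative H' (u x) (v x)) (at x)" by blast
  show ?case
    by (intro bexI[OF _ jet_polys.add[OF G'(1) H'(1)]]) (auto intro!: DERIV_add G' H')
next
  case (mult G H)
  then obtain G' H' where G': "G' \<in> jet_polys" "\<And>u v x. profile u v \<Longrightarrow>
      ((\<lambda>x. G (u x) (v x)) has_real_derivative G' (u x) (v x)) (at x)"
    and H': "H' \<in> jet_polys" "\<And>u v x. profile u v \<Longrightarrow>
      ((\<lambda>x. H (u x) (v x)) has_real_derivative H' (u x) (v x)) (at x)" by blast
  show ?case
    by (intro bexI[OF _ jet_polys.add[OF jet_polys.mult[OF G'(1) mult.hyps(2)] jet_polys.mult[OF H'(1) mult.hyps(1)]]])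
       (auto intro!: DERIV_mult G' H')
qed

text \<open>Reduces the j-th derivative of a difference to the Lipschitz bound for G. Equality as
  functions lets the induction differentiate once more.\<close>

lemma deriv_funpow_profile_diff:
  "\<exists>G\<in>jet_polys. \<forall>u v U V. profile u v \<longrightarrow> profile U V \<longrightarrow>
     (deriv ^^ j) (\<lambda>x. u x - U x) = (\<lambda>x. G (u x) (v x) - G (U x) (V x))"
proof (induction j)
  case 0
  show ?case by (intro bexI[OF _ jet_polys.proj1]) auto
next
  case (Suc j)
  then obtain G where G: "G \<in> jet_polys" "\<And>u v U V. profile u v \<Longrightarrow> profile U V \<Longrightarrow>
     (deriv ^^ j) (\<lambda>x. u x - U x) = (\<lambda>x. G (u x) (v x) - G (U x) (V x))" by blast
  obtain G' where G': "G' \<in> jet_polys" "\<And>u v x. profile u v \<Longrightarrow>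
      ((\<lambda>x. G (u x) (v x)) has_real_derivative G' (u x) (v x)) (at x)"
    using jet_polys_deriv[OF G(1)] by blast
  show ?case
  proof (intro bexI[OF _ G'(1)] allI impI)
    fix u v U V assume p: "profile u v" "profile U V"
    have "deriv (\<lambda>x. G (u x) (v x) - G (U x) (V x)) x = G' (u x) (v x) - G' (U x) (V x)" for x
      by (intro DERIV_imp_deriv DERIV_diff G' p)
    then show "(deriv ^^ Suc j) (\<lambda>x. u x - U x) = (\<lambda>x. G' (u x) (v x) - G' (U x) (V x))"
      using G(2)[OF p] by auto
  qed
qed

text \<open>Gronwall for the squared distance in the phase plane, where \<open>v 0 = V 0 = 0\<close>
  leaves only the gap of the amplitudes. K depends on M alone.\<close>

lemma profile_continuous_dependence:
  assumes "0 \<le> M"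
  shows "\<exists>K. \<forall>u v U V x. profile u v \<longrightarrow> profile U V \<longrightarrow> (\<forall>x. \<bar>u x\<bar> \<le> M) \<longrightarrow> (\<forall>x. \<bar>U x\<bar> \<le> M) \<longrightarrow>
     (u x - U x)\<^sup>2 + (v x - V x)\<^sup>2 \<le> (u 0 - U 0)\<^sup>2 * exp (K * \<bar>x\<bar>)"
proof -
  obtain K where K: "K \<ge> 0" "\<And>a a'. \<bar>a\<bar> \<le> M \<Longrightarrow> \<bar>a'\<bar> \<le> M \<Longrightarrow> \<bar>force a - force a'\<bar> \<le> K * \<bar>a - a'\<bar>"
    using jet_polys_Lipschitz[OF force_jet_poly assms] \<open>0 \<le> M\<close> by (metis abs_zero add.right_neutral diff_self)
  show ?thesis
  proof (intro exI[of _ "1 + K"] allI impI)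
    fix u v U V x
    assume p: "profile u v" "profile U V" and b: "\<forall>x. \<bar>u x\<bar> \<le> M" "\<forall>x. \<bar>U x\<bar> \<le> M"
    let ?N = "\<lambda>x. (u x - U x)\<^sup>2 + (v x - V x)\<^sup>2"
    let ?N' = "\<lambda>x. 2 * (u x - U x) * (v x - V x) + 2 * (v x - V x) * (force (u x) - force (U x))"
    have "(?N has_real_derivative ?N' x) (at x)" for x
      by (auto intro!: derivative_eq_intros profileD[OF p(1)] profileD[OF p(2)] simp: algebra_simps)
    moreover have "\<bar>?N' x\<bar> \<le> (1 + K) * ?N x" for x
    proof -
      let ?d = "\<bar>u x - U x\<bar>" and ?e = "\<bar>v x - V x\<bar>"
      have de: "2 * ?d * ?e \<le> ?N x"
        using sum_squares_bound[of ?d ?e] by simp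
      have "\<bar>?N' x\<bar> \<le> 2 * ?d * ?e + 2 * ?e * \<bar>force (u x) - force (U x)\<bar>"
        by (rule order_trans[OF abs_triangle_ineq]) (simp only: abs_mult abs_numeral order_refl)
      also have "\<dots> \<le> 2 * ?d * ?e + 2 * ?e * (K * ?d)"
        using K b by (intro add_left_mono mult_left_mono) auto
      also have "\<dots> = (1 + K) * (2 * ?d * ?e)" by (simp add: algebra_simps)
      also have "\<dots> \<le> (1 + K) * ?N x" using K(1) by (intro mult_left_mono de) auto
      finally show ?thesis .
    qed
    ultimately have "?N x \<le> ?N 0 * exp ((1 + K) * \<bar>x\<bar>)"
      by (rule abs_deriv_le_imp_exp_bound)
    then show "?N x \<le> (u 0 - U 0)\<^sup>2 * exp ((1 + K) * \<bar>x\<bar>)"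
      using profileD(3)[OF p(1)] profileD(3)[OF p(2)] by simp
  qed
qed

end

subsection \<open>The periodic and the solitary wave\<close>

context wave_parameters
begin

text \<open>\<open>PhiL\<close> with eta3 as a free parameter, so that its properties can be proved
  without the definite description.\<close>

definition dn_wave :: "real \<Rightarrow> real \<Rightarrow> real" where
  "dn_wave e x = sqrt (e * (jdn (ksq \<omega> c e) (x / (2 * gfun \<omega> c e)))\<^sup>2
     / (1 + betasq \<omega> c e * (jsn (ksq \<omega> c e) (x / (2 * gfun \<omega> c e)))\<^sup>2))"

lemma PhiL_eq_dn_wave: "PhiL \<omega> c L = dn_wave (eta3L \<omega> c L)"
  by (simp add: fun_eq_iff PhiL_def dn_wave_def Let_def)

text \<open>Coefficient matching for \<open>dn_wave_profile\<close>. With w = 1/e + B Z and Z =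
  sn^2/dn^2, the elliptic functions give w'' as a quadratic and w'^2 as a cubic in Z. The three
  equations with denominator \<open>2 * g\<^sup>2\<close> match the quadratic, the last equation
  matches the cubic.\<close>

lemma modulus_identities:
  assumes e: "e \<in> eta3_range"
  defines "k \<equiv> ksq \<omega> c e" and "g \<equiv> gfun \<omega> c e" and "B \<equiv> (ksq \<omega> c e + betasq \<omega> c e) / e"
    and "E \<equiv> \<eta>\<^sub>1 e * \<eta>\<^sub>2 e * e / 16"
  shows "0 < g" "0 < B" "0 < betasq \<omega> c e"
    and "B / g\<^sup>2 = (e - \<eta>\<^sub>2 e) * (e - \<eta>\<^sub>1 e) / (4 * e)"
    and "B / (2 * g\<^sup>2) = c / 2 + (4 * \<omega> - c\<^sup>2) / e + 6 * E / e\<^sup>2"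
    and "(4 * k - 2) / (2 * g\<^sup>2) = 4 * \<omega> - c\<^sup>2 + 12 * E / e"
    and "3 * k * (k - 1) / (2 * g\<^sup>2) = 6 * E * B"
    and "B / g\<^sup>2 * Z * (1 + k * Z) * (1 + (k - 1) * Z)
        = (- 1 + 4 * c * (1 / e + B * Z) + (16 * \<omega> - 4 * c\<^sup>2) * (1 / e + B * Z)\<^sup>2 + 16 * E * (1 / e + B * Z) ^ 3) / (4 * B)"
proof -
  define a b n where "a = \<eta>\<^sub>1 e" and "b = \<eta>\<^sub>2 e" and "n = b - a"
  have o: "a < 0" "0 < b" "b < e" using eta_order[OF e] by (auto simp: a_def b_def)
  have n: "0 < n" and e0: "0 < e" using o by (auto simp: n_def)
  have c: "c = (a + b + e) / 4" using eta_sum[of e] by (simp add: a_def b_def)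
  have \<omega>: "16 * \<omega> - 4 * c\<^sup>2 = - (a * b + a * e + b * e)"
    using eta_pair_sum[OF e] by (simp add: a_def b_def)
  have k: "k = - a * (e - b) / (e * n)"
    by (simp add: k_def ksq_def a_def b_def n_def)
  have beta: "betasq \<omega> c e = (e - b) / n"
    unfolding betasq_def k_def[symmetric] k a_def[symmetric] using o n e0 by (simp add: field_simps)
  show "0 < betasq \<omega> c e" using o n by (simp add: beta)
  have g2: "g\<^sup>2 = 4 / (e * n)"
    using e0 n by (simp add: g_def gfun_def power_divide a_def b_def n_def)
  show "0 < g" using e0 n by (simp add: g_def gfun_def a_def b_def n_def)
  have B: "B = (e - b) * (e - a) / (e * e * n)"
    unfolding B_def k_def[symmetric] beta k using e0 n by (simp add: field_simps)
  show Bpos: "0 < B" unfolding B using o e0 n by simp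
  show Bg: "B / g\<^sup>2 = (e - \<eta>\<^sub>2 e) * (e - \<eta>\<^sub>1 e) / (4 * e)"
    unfolding B g2 a_def[symmetric] b_def[symmetric] using e0 n by (simp add: field_simps)
  have E: "E = a * b * e / 16" by (simp add: E_def a_def b_def)
  have \<omega>': "4 * \<omega> - c\<^sup>2 = - (a * b + a * e + b * e) / 4" using \<omega> by simp
  have Bg2: "B / (2 * g\<^sup>2) = (e - b) * (e - a) / (8 * e)"
    using Bg by (simp add: a_def b_def)
  show "B / (2 * g\<^sup>2) = c / 2 + (4 * \<omega> - c\<^sup>2) / e + 6 * E / e\<^sup>2"
    unfolding Bg2 \<omega>' E unfolding c using e0 by (simp add: field_simps power2_eq_square)
  show "(4 * k - 2) / (2 * g\<^sup>2) = 4 * \<omega> - c\<^sup>2 + 12 * E / e"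
    unfolding g2 k \<omega>' E using e0 n by (simp add: field_simps) (simp add: n_def algebra_simps)
  have k1: "k - 1 = - b * (e - a) / (e * n)"
    unfolding k using e0 n by (simp add: field_simps) (simp add: n_def algebra_simps)
  show "3 * k * (k - 1) / (2 * g\<^sup>2) = 6 * E * B"
    unfolding k1 unfolding g2 k E B using e0 n by (simp add: field_simps)
  define w where "w = 1 / e + B * Z"
  have f1: "e * w - 1 = e * B * Z" using e0 by (simp add: w_def algebra_simps)
  have f2: "1 - b * w = (e - b) / e * (1 + (k - 1) * Z)"
    unfolding w_def k1 B using e0 n by (simp add: field_simps)
  have f3: "1 - a * w = (e - a) / e * (1 + k * Z)"
    unfolding w_def k B using e0 n by (simp add: field_simps)
  \<comment> \<open>By Vieta the zeros of the cubic are the reciprocals of e, eta2 and eta1; each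
    linear factor is affine in Z.\<close>
  have "- 1 + 4 * c * w + (16 * \<omega> - 4 * c\<^sup>2) * w\<^sup>2 + 16 * E * w ^ 3 = (e * w - 1) * (1 - b * w) * (1 - a * w)"
    unfolding \<omega> E unfolding c by (simp add: algebra_simps power2_eq_square power3_eq_cube)
  also have "\<dots> = e * B * Z * ((e - b) / e * (1 + (k - 1) * Z)) * ((e - a) / e * (1 + k * Z))"
    unfolding f1 f2 f3 ..
  finally have fac: "- 1 + 4 * c * w + (16 * \<omega> - 4 * c\<^sup>2) * w\<^sup>2 + 16 * E * w ^ 3
    = e * B * Z * ((e - b) / e * (1 + (k - 1) * Z)) * ((e - a) / e * (1 + k * Z))" .
  show "B / g\<^sup>2 * Z * (1 + k * Z) * (1 + (k - 1) * Z)
        = (- 1 + 4 * c * (1 / e + B * Z) + (16 * \<omega> - 4 * c\<^sup>2) * (1 / e + B * Z)\<^sup>2 + 16 * E * (1 / e + B * Z) ^ 3) / (4 * B)"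
    unfolding Bg w_def[symmetric] fac a_def[symmetric] b_def[symmetric] using e0 Bpos
    by (simp add: divide_simps) (simp add: algebra_simps)
qed

text \<open>The reciprocal of the squared wave is affine in sn^2/dn^2. Both the differential
  equation and the decay are read off from this form.\<close>

lemma dn_wave_eq_inverse_sqrt:
  assumes e: "e \<in> eta3_range"
  defines "k \<equiv> ksq \<omega> c e" and "g \<equiv> gfun \<omega> c e"
  defines "s \<equiv> \<lambda>x. jsn k (x / (2 * g))"
  shows "dn_wave e x = 1 / sqrt (1 / e + (k + betasq \<omega> c e) / e * ((s x)\<^sup>2 / (1 - k * (s x)\<^sup>2)))"
proof -
  have k: "0 \<le> k" "k < 1" using ksq_bounds[OF e] by (auto simp: k_def)
  define S where "S = (s x)\<^sup>2"
  have D: "0 < 1 - k * S" using one_minus_sin_sq_pos[OF k] by (simp add: S_def s_def jsn_def)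
  have S: "0 \<le> S" by (simp add: S_def)
  have b: "0 < betasq \<omega> c e" by (rule modulus_identities(3)[OF e])
  have Q: "0 < 1 + betasq \<omega> c e * S" using b S by (simp add: add_pos_nonneg)
  have e0: "0 < e" using Apoly_bounds[OF e] by simp
  have "dn_wave e x = sqrt (e * (1 - k * S) / (1 + betasq \<omega> c e * S))"
    using D unfolding S_def s_def by (simp add: dn_wave_def jdn_def k_def[symmetric] g_def[symmetric])
  also have "e * (1 - k * S) / (1 + betasq \<omega> c e * S) = 1 / (1 / e + (k + betasq \<omega> c e) / e * (S / (1 - k * S)))"
  proof -
    have "1 / e + (k + betasq \<omega> c e) / e * (S / (1 - k * S)) = (1 + betasq \<omega> c e * S) / (e * (1 - k * S))"
      using e0 D by (simp add: divide_simps) (simp add: algebra_simps)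
    then show ?thesis using Q by simp
  qed
  finally show ?thesis by (simp add: real_sqrt_divide S_def)
qed

lemma dn_wave_profile:
  assumes e: "e \<in> eta3_range"
  shows "\<exists>v. profile (dn_wave e) v"
proof -
  define k g B E where "k = ksq \<omega> c e" and "g = gfun \<omega> c e"
    and "B = (ksq \<omega> c e + betasq \<omega> c e) / e" and "E = \<eta>\<^sub>1 e * \<eta>\<^sub>2 e * e / 16"
  note I = modulus_identities[OF e, folded k_def g_def B_def[unfolded k_def] E_def, folded B_def]
  have k: "0 \<le> k" "k < 1" using ksq_bounds[OF e] by (auto simp: k_def)
  have e0: "0 < e" using Apoly_bounds[OF e] by simp
  define \<phi> where "\<phi> x = jam k (x / (2 * g))" for x
  define D where "D x = 1 - k * (sin (\<phi> x))\<^sup>2" for x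
  define Z where "Z x = (sin (\<phi> x))\<^sup>2 / D x" for x
  define w where "w x = 1 / e + B * Z x" for x
  define w1 where "w1 x = B / g * (sin (\<phi> x) * cos (\<phi> x) / (D x * sqrt (D x)))" for x
  have D: "0 < D x" for x unfolding D_def by (rule one_minus_sin_sq_pos[OF k])
  have d\<phi>: "(\<phi> has_real_derivative sqrt (D x) / (2 * g)) (at x)" for x
    unfolding \<phi>_def D_def
    by (rule DERIV_cong[OF DERIV_chain2[OF DERIV_jam[OF k]]])
       (use I(1) in \<open>auto intro!: derivative_eq_intros\<close>)
  have dD: "(D has_real_derivative - (2 * k * sin (\<phi> x) * cos (\<phi> x) * (sqrt (D x) / (2 * g)))) (at x)" for x
    unfolding D_def[abs_def]
    by (auto intro!: derivative_eq_intros d\<phi> simp: D_def)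
  \<comment> \<open>1/dn^2 and cn^2/dn^2 are affine in Z, which turns all derivatives below into
    polynomials in Z.\<close>
  have invD: "1 / D x = 1 + k * Z x" for x
    using D[of x] unfolding Z_def by (simp add: field_simps) (simp add: D_def)
  have cosZ: "(cos (\<phi> x))\<^sup>2 / D x = 1 + (k - 1) * Z x" for x
  proof -
    have "(cos (\<phi> x))\<^sup>2 / D x = 1 / D x - Z x"
      by (simp add: Z_def cos_squared_eq diff_divide_distrib)
    then show ?thesis by (simp add: invD algebra_simps)
  qed
  have "profile (\<lambda>x. 1 / sqrt (w x)) (\<lambda>x. - w1 x / (2 * sqrt (w x) ^ 3))"
  proof (rule profile_inverse_sqrt[where E = E])
    fix x
    define s t r where "s = sin (\<phi> x)" and "t = cos (\<phi> x)" and "r = sqrt (D x)"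
    have r: "0 < r" "D x = r\<^sup>2" using D[of x] by (auto simp: r_def)
    have t2: "t\<^sup>2 = 1 - s\<^sup>2" by (simp add: s_def t_def cos_squared_eq)
    have r2: "r\<^sup>2 = 1 - k * s\<^sup>2" using r(2) by (simp add: D_def s_def)
    have "0 \<le> Z x" using D[of x] by (simp add: Z_def)
    then show "0 < w x" unfolding w_def using e0 I(2) by (intro add_pos_nonneg) auto
    have "(w has_real_derivative
        B * ((2 * s * (t * (r / (2 * g))) * r\<^sup>2 - s\<^sup>2 * - (2 * k * s * t * (r / (2 * g)))) / (r\<^sup>2 * r\<^sup>2))) (at x)"
      unfolding w_def Z_def using D[of x]
      by (auto intro!: derivative_eq_intros d\<phi> dD
          simp: s_def[symmetric] t_def[symmetric] r_def[symmetric] r(2) abs_of_pos[OF r(1)] algebra_simps)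
    also have "B * ((2 * s * (t * (r / (2 * g))) * r\<^sup>2 - s\<^sup>2 * - (2 * k * s * t * (r / (2 * g)))) / (r\<^sup>2 * r\<^sup>2))
        = B / g * (s * t * (r\<^sup>2 + k * s\<^sup>2) / (r\<^sup>2 * r))"
      using r(1) I(1) by (simp add: divide_simps) (simp add: algebra_simps eval_nat_numeral)
    also have "\<dots> = w1 x"
    proof -
      have "r\<^sup>2 + k * s\<^sup>2 = 1" by (simp add: r2)
      then show ?thesis
        unfolding w1_def r_def[symmetric] s_def[symmetric] t_def[symmetric] r(2) using r(1) by simp
    qed
    finally show "(w has_real_derivative w1 x) (at x)" .
    have "(w1 has_real_derivative B / g *
       (((t * (r / (2 * g)) * t + s * (- s * (r / (2 * g)))) * (r\<^sup>2 * r)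
          - s * t * (- (2 * k * s * t * (r / (2 * g))) * r + r\<^sup>2 * - (k * s * t / (2 * g)))) / ((r\<^sup>2 * r) * (r\<^sup>2 * r)))) (at x)"
      unfolding w1_def
      by (rule DERIV_cmult)
         (use D[of x] r(1) I(1) in \<open>auto intro!: derivative_eq_intros d\<phi> dD
             simp: s_def[symmetric] t_def[symmetric] r_def[symmetric] r(2) field_simps\<close>)
    also have "B / g *
       (((t * (r / (2 * g)) * t + s * (- s * (r / (2 * g)))) * (r\<^sup>2 * r)
          - s * t * (- (2 * k * s * t * (r / (2 * g))) * r + r\<^sup>2 * - (k * s * t / (2 * g)))) / ((r\<^sup>2 * r) * (r\<^sup>2 * r)))
       = B / (2 * g\<^sup>2) * (t\<^sup>2 / r\<^sup>2 - s\<^sup>2 / r\<^sup>2 + 3 * k * (s\<^sup>2 / r\<^sup>2) * (t\<^sup>2 / r\<^sup>2))"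
      using r(1) I(1) by (simp add: divide_simps) (simp add: algebra_simps eval_nat_numeral)
    also have "\<dots> = B / (2 * g\<^sup>2) * ((1 + (k - 1) * Z x) - Z x + 3 * k * Z x * (1 + (k - 1) * Z x))"
      unfolding cosZ[symmetric] by (simp add: Z_def s_def t_def r(2)[symmetric])
    also have "\<dots> = B / (2 * g\<^sup>2) + (4 * k - 2) / (2 * g\<^sup>2) * (B * Z x) + 3 * k * (k - 1) / (2 * g\<^sup>2) * (B * (Z x)\<^sup>2)"
      by (simp add: diff_divide_distrib add_divide_distrib algebra_simps power2_eq_square)
    also have "\<dots> = c / 2 + (4 * \<omega> - c\<^sup>2) * w x + 6 * E * (w x)\<^sup>2"
      unfolding I(5,6,7) w_def using e0 by (simp add: field_simps power2_eq_square)
    finally show "(w1 has_real_derivative c / 2 + (4 * \<omega> - c\<^sup>2) * w x + 6 * E * (w x)\<^sup>2) (at x)" .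
    have "(w1 x)\<^sup>2 = B * (B / g\<^sup>2 * (s\<^sup>2 / r\<^sup>2) * (1 / r\<^sup>2) * (t\<^sup>2 / r\<^sup>2))"
      unfolding w1_def r(2) s_def[symmetric] t_def[symmetric] using r(1)
      by (simp add: power_divide power_mult_distrib power2_eq_square mult_ac)
    also have "\<dots> = B * (B / g\<^sup>2 * Z x * (1 + k * Z x) * (1 + (k - 1) * Z x))"
      unfolding cosZ[symmetric] invD[symmetric] by (simp add: Z_def s_def t_def r(2)[symmetric])
    also have "\<dots> = (- 1 + 4 * c * w x + (16 * \<omega> - 4 * c\<^sup>2) * (w x)\<^sup>2 + 16 * E * (w x) ^ 3) / 4"
      unfolding I(8) w_def[symmetric] using I(2) by simp
    finally show "(w1 x)\<^sup>2 = (- 1 + 4 * c * w x + (16 * \<omega> - 4 * c\<^sup>2) * (w x)\<^sup>2 + 16 * E * (w x) ^ 3) / 4" .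
  next
    show "w1 0 = 0" using k by (simp add: w1_def \<phi>_def)
  qed
  moreover have "(\<lambda>x. 1 / sqrt (w x)) = dn_wave e"
    using dn_wave_eq_inverse_sqrt[OF e] by (simp add: fun_eq_iff w_def Z_def D_def \<phi>_def jsn_def k_def g_def B_def)
  ultimately show ?thesis by auto
qed

section \<open>Amplitude, decay and energy of the periodic wave\<close>

lemma dn_wave_0:
  assumes e: "e \<in> eta3_range"
  shows "dn_wave e 0 = sqrt e"
  using dn_wave_eq_inverse_sqrt[OF e, of 0] ksq_bounds[OF e] by (simp add: jsn_def real_sqrt_divide)

text \<open>The condition on x says that the elliptic argument is at most K in absolute value. B and
  g may both diverge as e tends to alpha1 (for \<omega> = c^2/4), but only B / g^2 = (e - eta2) (e -
  eta1) / (4 e) enters.\<close>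

lemma dn_wave_square_le:
  assumes e: "e \<in> eta3_range"
  shows "(dn_wave e x)\<^sup>2 \<le> e"
    and "\<bar>x\<bar> \<le> Tper \<omega> c e / 2 \<Longrightarrow> (dn_wave e x)\<^sup>2 \<le> e / (1 + (e - \<eta>\<^sub>2 e) * (e - \<eta>\<^sub>1 e) / (4 * pi\<^sup>2) * x\<^sup>2)"
proof -
  define k g B where "k = ksq \<omega> c e" and "g = gfun \<omega> c e" and "B = (ksq \<omega> c e + betasq \<omega> c e) / e"
  note I = modulus_identities[OF e, folded k_def g_def B_def[unfolded k_def], folded B_def]
  have k: "0 \<le> k" "k < 1" using ksq_bounds[OF e] by (auto simp: k_def)
  have e0: "0 < e" using Apoly_bounds[OF e] by simp
  define Z where "Z = (jsn k (x / (2 * g)))\<^sup>2 / (1 - k * (jsn k (x / (2 * g)))\<^sup>2)"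
  have Z: "0 \<le> Z" using one_minus_sin_sq_pos[OF k, of "jam k (x / (2 * g))"] by (simp add: Z_def jsn_def)
  have sq: "(dn_wave e x)\<^sup>2 = 1 / (1 / e + B * Z)"
  proof -
    have "dn_wave e x = 1 / sqrt (1 / e + B * Z)"
      by (simp add: dn_wave_eq_inverse_sqrt[OF e] Z_def B_def k_def g_def)
    moreover have "0 \<le> 1 / e + B * Z" using e0 I(2) Z by (intro add_nonneg_nonneg) auto
    ultimately show ?thesis by (simp add: power_divide)
  qed
  also have "\<dots> = e / (1 + e * B * Z)" using e0 by (simp add: field_simps)
  finally have sq: "(dn_wave e x)\<^sup>2 = e / (1 + e * B * Z)" .
  have pos: "0 \<le> e * B * Z" using e0 I(2) Z by simp
  have "e / (1 + e * B * Z) \<le> e / 1" using e0 pos by (intro divide_left_mono) auto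
  then show "(dn_wave e x)\<^sup>2 \<le> e" by (simp add: sq)
  assume x: "\<bar>x\<bar> \<le> Tper \<omega> c e / 2"
  then have "\<bar>x / (2 * g)\<bar> \<le> ellK k"
    using I(1) by (simp add: Tper_def k_def[symmetric] g_def[symmetric] field_simps abs_mult)
  from jsn_over_jdn_ge[OF k this] have "(x / (pi * g))\<^sup>2 \<le> Z" by (simp add: Z_def)
  then have "e * B * (x / (pi * g))\<^sup>2 \<le> e * B * Z"
    using e0 I(2) by (intro mult_left_mono) auto
  moreover have "e * B * (x / (pi * g))\<^sup>2 = e * (B / g\<^sup>2) * x\<^sup>2 / pi\<^sup>2"
    by (simp add: power_divide power_mult_distrib)
  moreover have "e * (B / g\<^sup>2) * x\<^sup>2 / pi\<^sup>2 = (e - \<eta>\<^sub>2 e) * (e - \<eta>\<^sub>1 e) / (4 * pi\<^sup>2) * x\<^sup>2"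
    unfolding I(4) using e0 by simp
  ultimately have le: "(e - \<eta>\<^sub>2 e) * (e - \<eta>\<^sub>1 e) / (4 * pi\<^sup>2) * x\<^sup>2 \<le> e * B * Z" by simp
  have "0 \<le> (e - \<eta>\<^sub>2 e) * (e - \<eta>\<^sub>1 e) / (4 * pi\<^sup>2) * x\<^sup>2"
    using eta_order[OF e] by (intro mult_nonneg_nonneg divide_nonneg_nonneg) auto
  then show "(dn_wave e x)\<^sup>2 \<le> e / (1 + (e - \<eta>\<^sub>2 e) * (e - \<eta>\<^sub>1 e) / (4 * pi\<^sup>2) * x\<^sup>2)"
    unfolding sq using le e0 pos by (intro divide_left_mono) (auto intro!: mult_pos_pos)
qed

text \<open>This is -E for amplitude \<open>sqrt e\<close>: nonnegative on the range, and zero at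
  alpha1, where e - 2c = 4 sqrt \<omega>.\<close>

lemma potential_sqrt:
  assumes "0 \<le> e"
  shows "potential (sqrt e) = e / 16 * (16 * \<omega> - (e - 2 * c)\<^sup>2)"
proof -
  have p: "sqrt e ^ 4 = e\<^sup>2" "sqrt e ^ 6 = e ^ 3"
    using assms power_mult[of "sqrt e" 2 2] power_mult[of "sqrt e" 2 3] by simp_all
  show ?thesis
    using assms unfolding potential_def p by (simp add: power2_eq_square power3_eq_cube algebra_simps)
qed

lemma potential_sqrt_nonneg:
  assumes "e \<in> eta3_range"
  shows "0 \<le> potential (sqrt e)"
proof -
  note b = Apoly_bounds[OF assms]
  have "(e - 2 * c)\<^sup>2 < 16 * \<omega>"
    using b(2) by (simp add: Apoly_def power2_eq_square algebra_simps)
  then show ?thesis using b(1) by (simp add: potential_sqrt)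
qed

text \<open>For E = 0 the equation for w = 1/u^2 is linear, w'' = c/2 + (4\<omega> - c^2) w, with a
  hyperbolic cosine or, in the borderline case, a parabola as solution. The minimum of w at 0 gives
  the amplitude and the upper bound.\<close>

lemma Phi_profile: "\<exists>v. profile (Phi \<omega> c) v"
  and Phi_0: "Phi \<omega> c 0 = sqrt (alpha1 \<omega> c)"
  and Phi_square_le: "(Phi \<omega> c x)\<^sup>2 \<le> alpha1 \<omega> c"
proof -
  have "(\<exists>v. profile (Phi \<omega> c) v) \<and> Phi \<omega> c 0 = sqrt (alpha1 \<omega> c) \<and>
    (\<forall>x. (Phi \<omega> c x)\<^sup>2 \<le> alpha1 \<omega> c)"
  proof (cases "\<omega> > c\<^sup>2 / 4")
    case True
    define b q where "b = 4 * \<omega> - c\<^sup>2" and "q = sqrt \<omega>"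
    have b: "0 < b" using True by (simp add: b_def)
    have q: "0 < q" "q\<^sup>2 = \<omega>" using omega_pos by (auto simp: q_def)
    have bq: "b = (2 * q - c) * (2 * q + c)" by (simp add: b_def q(2)[symmetric] power2_eq_square algebra_simps)
    have cq: "0 < 2 * q - c" using b c_gt unfolding bq by (simp add: q_def zero_less_mult_iff)
    define w where "w x = (q * cosh (sqrt b * x) - c / 2) / b" for x
    define w1 where "w1 x = q * sinh (sqrt b * x) / sqrt b" for x
    have ge: "(q - c / 2) / b \<le> w x" for x
      unfolding w_def using q b cosh_real_ge_1[of "sqrt b * x"] by (intro divide_right_mono) auto
    have w: "0 < w x" for x
      using less_le_trans[OF divide_pos_pos ge[of x]] b cq by simp
    have Phi: "Phi \<omega> c x = 1 / sqrt (w x)" for x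
    proof -
      have "Phi \<omega> c x = sqrt (b / (q * cosh (sqrt b * x) - c / 2))"
        using True q(1) by (simp add: Phi_def b_def q_def right_diff_distrib)
      also have "b / (q * cosh (sqrt b * x) - c / 2) = 1 / w x" by (simp add: w_def)
      finally show ?thesis by (simp add: real_sqrt_divide)
    qed
    have "profile (\<lambda>x. 1 / sqrt (w x)) (\<lambda>x. - w1 x / (2 * sqrt (w x) ^ 3))"
    proof (rule profile_inverse_sqrt[where E = 0])
      fix x
      define C S where "C = cosh (sqrt b * x)" and "S = sinh (sqrt b * x)"
      have CS: "S\<^sup>2 = C\<^sup>2 - 1" by (simp add: C_def S_def sinh_square_eq)
      show "0 < w x" by (rule w)
      have "(w has_real_derivative q * (S * sqrt b) / b) (at x)"
        unfolding w_def using b by (auto intro!: derivative_eq_intros simp: S_def)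
      also have "q * (S * sqrt b) / b = w1 x"
        using b by (simp add: w1_def S_def field_simps)
      finally show "(w has_real_derivative w1 x) (at x)" .
      have "(w1 has_real_derivative q * C) (at x)"
      proof -
        have "((\<lambda>x. sinh (sqrt b * x)) has_real_derivative C * sqrt b) (at x)"
          by (auto intro!: derivative_eq_intros simp: C_def)
        from DERIV_cdivide[OF DERIV_cmult[OF this, of q], of "sqrt b"] show ?thesis
          unfolding w1_def using b by simp
      qed
      also have "q * C = c / 2 + (4 * \<omega> - c\<^sup>2) * w x + 6 * 0 * (w x)\<^sup>2"
        using b unfolding b_def[symmetric] by (simp add: w_def C_def)
      finally show "(w1 has_real_derivative c / 2 + (4 * \<omega> - c\<^sup>2) * w x + 6 * 0 * (w x)\<^sup>2) (at x)" .
      have "(w1 x)\<^sup>2 = \<omega> * (C\<^sup>2 - 1) / b"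
        using b by (simp add: w1_def S_def[symmetric] power_divide power_mult_distrib q(2) CS)
      also have "\<dots> = (- 1 + 4 * c * w x + 4 * b * (w x)\<^sup>2) / 4"
      proof -
        have \<omega>: "\<omega> = (b + c\<^sup>2) / 4" by (simp add: b_def)
        have C: "q * C = b * w x + c / 2" using b by (simp add: w_def C_def)
        have "\<omega> * (C\<^sup>2 - 1) = (q * C)\<^sup>2 - \<omega>" by (simp add: power_mult_distrib q(2) algebra_simps)
        also have "\<dots> = b\<^sup>2 * (w x)\<^sup>2 + b * c * w x - b / 4"
          unfolding C \<omega> by (simp add: power2_eq_square field_simps)
        also have "\<dots> = b * ((- 1 + 4 * c * w x + 4 * b * (w x)\<^sup>2) / 4)"
          by (simp add: field_simps power2_eq_square)
        finally show ?thesis using b by simp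
      qed
      finally show "(w1 x)\<^sup>2 = (- 1 + 4 * c * w x + (16 * \<omega> - 4 * c\<^sup>2) * (w x)\<^sup>2 + 16 * 0 * (w x) ^ 3) / 4"
        by (simp add: b_def)
    qed (simp add: w1_def)
    \<comment> \<open>The factor 2 q - c of b cancels, leaving 1 / (2 (2 q + c)).\<close>
    moreover have wa: "(q - c / 2) / b = 1 / alpha1 \<omega> c"
    proof -
      define d where "d = 2 * q - c"
      have "q - c / 2 = d / 2" "alpha1 \<omega> c = 2 * (2 * q + c)" "d \<noteq> 0"
        using cq by (simp_all add: alpha1_def q_def d_def)
      then show ?thesis unfolding bq d_def[symmetric] by (simp only:) simp
    qed
    moreover have "(Phi \<omega> c x)\<^sup>2 \<le> alpha1 \<omega> c" for x
    proof -
      have "(Phi \<omega> c x)\<^sup>2 = 1 / w x" using w[of x] by (simp add: Phi power_divide)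
      also have "\<dots> \<le> alpha1 \<omega> c"
        using ge[of x] w[of x] alpha1_pos unfolding wa by (simp add: field_simps)
      finally show ?thesis .
    qed
    moreover have "w 0 = (q - c / 2) / b" by (simp add: w_def)
    moreover have "Phi \<omega> c = (\<lambda>x. 1 / sqrt (w x))" by (simp add: Phi fun_eq_iff)
    ultimately show ?thesis by (auto simp: real_sqrt_divide)
  next
    case False
    then have c: "0 < c" "4 * \<omega> = c\<^sup>2" using admissible by auto
    then have "\<omega> = (c / 2)\<^sup>2" by (simp add: power_divide)
    then have a1: "alpha1 \<omega> c = 4 * c" using c(1) by (simp add: alpha1_def)
    define w where "w x = ((c * x)\<^sup>2 + 1) / (4 * c)" for x
    have w: "0 < w x" for x using c(1) by (simp add: w_def add_nonneg_pos)
    have Phi: "Phi \<omega> c x = 1 / sqrt (w x)" for x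
      using False by (simp add: Phi_def w_def real_sqrt_divide)
    have "profile (\<lambda>x. 1 / sqrt (w x)) (\<lambda>x. - (c * x / 2) / (2 * sqrt (w x) ^ 3))"
    proof (rule profile_inverse_sqrt[where E = 0])
      fix x
      show "0 < w x" by (rule w)
      show "(w has_real_derivative c * x / 2) (at x)"
        unfolding w_def using c(1) by (auto intro!: derivative_eq_intros simp: field_simps power2_eq_square)
      show "((\<lambda>x. c * x / 2) has_real_derivative c / 2 + (4 * \<omega> - c\<^sup>2) * w x + 6 * 0 * (w x)\<^sup>2) (at x)"
        using c(2) by (auto intro!: derivative_eq_intros)
      have "16 * \<omega> = 4 * c\<^sup>2" using c(2) by simp
      then show "(c * x / 2)\<^sup>2 = (- 1 + 4 * c * w x + (16 * \<omega> - 4 * c\<^sup>2) * (w x)\<^sup>2 + 16 * 0 * (w x) ^ 3) / 4"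
        using c(1) by (simp add: w_def power_divide)
    qed simp
    moreover have "(Phi \<omega> c x)\<^sup>2 \<le> alpha1 \<omega> c" for x
    proof -
      have "(Phi \<omega> c x)\<^sup>2 = 4 * c / ((c * x)\<^sup>2 + 1)" using w[of x] by (simp add: Phi power_divide) (simp add: w_def)
      also have "\<dots> \<le> 4 * c / 1" using c(1) by (intro divide_left_mono) (auto intro!: add_nonneg_pos)
      finally show ?thesis by (simp add: a1)
    qed
    moreover have "Phi \<omega> c 0 = sqrt (alpha1 \<omega> c)" using False by (simp add: Phi_def a1)
    moreover have "Phi \<omega> c = (\<lambda>x. 1 / sqrt (w x))" by (simp add: Phi fun_eq_iff)
    ultimately show ?thesis by auto
  qed
  then show "\<exists>v. profile (Phi \<omega> c) v" "Phi \<omega> c 0 = sqrt (alpha1 \<omega> c)" "(Phi \<omega> c x)\<^sup>2 \<le> alpha1 \<omega> c"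
    by auto
qed

section \<open>Bounds uniform in L and the limit\<close>

lemma profile_deriv: "profile u v \<Longrightarrow> profile u (deriv u)"
proof -
  assume p: "profile u v"
  then have "deriv u = v" by (auto intro!: DERIV_imp_deriv profileD)
  with p show ?thesis by simp
qed

lemma eventually_PhiL_dominated:
  "\<exists>D. \<forall>\<^sub>F L in at_top. \<forall>x. \<bar>x\<bar> \<le> L \<longrightarrow> (PhiL \<omega> c L x)\<^sup>2 \<le> D / (1 + x\<^sup>2)"
proof -
  define e0 where "e0 = (alpha0 \<omega> c + alpha1 \<omega> c) / 2"
  have e0: "e0 \<in> eta3_range" using alpha0_less_alpha1 by (auto simp: e0_def)
  \<comment> \<open>Beyond \<open>e0\<close> the factor e - eta2 has grown and e - eta1 exceeds e >
    e0, so \<kappa> bounds the decay coefficient from below for all large L.\<close>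
  define \<kappa> where "\<kappa> = (e0 - \<eta>\<^sub>2 e0) * e0 / (4 * pi\<^sup>2)"
  have \<kappa>: "0 < \<kappa>" using eta_order[OF e0] by (simp add: \<kappa>_def)
  \<comment> \<open>Chosen because 1 + x^2 \<le> (1 + 1/\<kappa>) (1 + \<kappa> x^2).\<close>
  let ?D = "alpha1 \<omega> c * (1 + 1 / \<kappa>)"
  show ?thesis
  proof (rule exI[of _ ?D], use eventually_eta3L[OF e0] in eventually_elim, intro allI impI)
    fix L x :: real
    assume L: "e0 < eta3L \<omega> c L \<and> eta3L \<omega> c L \<in> eta3_range \<and> Tper \<omega> c (eta3L \<omega> c L) = 2 * L" and x: "\<bar>x\<bar> \<le> L"
    define e where "e = eta3L \<omega> c L"
    have e: "e0 < e" "e \<in> eta3_range" "Tper \<omega> c e = 2 * L" using L by (auto simp: e_def)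
    note o = eta_order[OF e(2)] eta_order[OF e0]
    have "\<kappa> \<le> (e - \<eta>\<^sub>2 e) * (e - \<eta>\<^sub>1 e) / (4 * pi\<^sup>2)"
      unfolding \<kappa>_def using o e(1) eta2_strict_antimono[OF e0 e(2,1)]
      by (intro divide_right_mono mult_mono) auto
    then have le: "1 + \<kappa> * x\<^sup>2 \<le> 1 + (e - \<eta>\<^sub>2 e) * (e - \<eta>\<^sub>1 e) / (4 * pi\<^sup>2) * x\<^sup>2"
      by (intro add_left_mono mult_right_mono) auto
    have p: "0 < 1 + \<kappa> * x\<^sup>2" using \<kappa> by (intro add_pos_nonneg) auto
    have "(PhiL \<omega> c L x)\<^sup>2 \<le> e / (1 + (e - \<eta>\<^sub>2 e) * (e - \<eta>\<^sub>1 e) / (4 * pi\<^sup>2) * x\<^sup>2)"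
      unfolding PhiL_eq_dn_wave e_def[symmetric] using x e(3) by (intro dn_wave_square_le(2)[OF e(2)]) auto
    also have "\<dots> \<le> alpha1 \<omega> c / (1 + \<kappa> * x\<^sup>2)"
      using le p e(2) o alpha1_pos by (intro frac_le) auto
    also have "\<dots> \<le> ?D / (1 + x\<^sup>2)"
    proof -
      have x2: "0 < 1 + x\<^sup>2" by (intro add_pos_nonneg) auto
      have "1 + x\<^sup>2 \<le> (1 + 1 / \<kappa>) * (1 + \<kappa> * x\<^sup>2)"
        using \<kappa> by (simp add: algebra_simps)
      then have "alpha1 \<omega> c * (1 + x\<^sup>2) \<le> ?D * (1 + \<kappa> * x\<^sup>2)"
        using alpha1_pos by (simp add: mult.assoc)
      then show ?thesis using p x2 by (simp add: divide_simps mult_ac)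
    qed
    finally show "(PhiL \<omega> c L x)\<^sup>2 \<le> ?D / (1 + x\<^sup>2)" .
  qed
qed

lemma eventually_PhiL_profile:
  "\<forall>\<^sub>F L in at_top. profile (PhiL \<omega> c L) (deriv (PhiL \<omega> c L)) \<and> PhiL \<omega> c L 0 = sqrt (eta3L \<omega> c L) \<and>
     0 \<le> potential (PhiL \<omega> c L 0) \<and> (\<forall>x. (PhiL \<omega> c L x)\<^sup>2 \<le> alpha1 \<omega> c)"
proof -
  have "(alpha0 \<omega> c + alpha1 \<omega> c) / 2 \<in> eta3_range" using alpha0_less_alpha1 by auto
  from eventually_eta3L[OF this] show ?thesis
  proof eventually_elim
    case (elim L)
    then have e: "eta3L \<omega> c L \<in> eta3_range" by blast
    have "(dn_wave (eta3L \<omega> c L) x)\<^sup>2 \<le> alpha1 \<omega> c" for x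
      using dn_wave_square_le(1)[OF e, of x] e by simp
    then show ?case
      using dn_wave_profile[OF e] profile_deriv dn_wave_0[OF e] potential_sqrt_nonneg[OF e]
      by (auto simp: PhiL_eq_dn_wave)
  qed
qed

lemma Hm_norm_diff_tendsto_zero:
  "((\<lambda>L. Hm_norm m L (\<lambda>x. PhiL \<omega> c L x - Phi \<omega> c x)) \<longlongrightarrow> 0) at_top"
proof -
  define B where "B = \<omega> + \<bar>c\<bar> * alpha1 \<omega> c"
  \<comment> \<open>Bounds both phase plane coordinates of both waves, so one box serves all
    Lipschitz estimates.\<close>
  define M where "M = sqrt (alpha1 \<omega> c) + sqrt (B * alpha1 \<omega> c)"
  define N where "N L x = (PhiL \<omega> c L x - Phi \<omega> c x)\<^sup>2 + (deriv (PhiL \<omega> c L) x - deriv (Phi \<omega> c) x)\<^sup>2" for L x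
  have B: "0 < B" using omega_pos alpha1_pos by (simp add: B_def add_pos_nonneg)
  have pPhi: "profile (Phi \<omega> c) (deriv (Phi \<omega> c))"
    using Phi_profile profile_deriv by blast
  have "potential (Phi \<omega> c 0) = 0"
    using omega_pos alpha1_pos by (simp add: Phi_0 potential_sqrt) (simp add: alpha1_def power_mult_distrib)
  then have dPhi: "(deriv (Phi \<omega> c) x)\<^sup>2 \<le> B * (Phi \<omega> c x)\<^sup>2" for x
    unfolding B_def by (intro profile_deriv_le[OF pPhi] Phi_square_le) simp
  have bounds: "\<bar>a\<bar> \<le> sqrt (alpha1 \<omega> c)" "\<bar>a\<bar> \<le> M" "\<bar>b\<bar> \<le> M" if "a\<^sup>2 \<le> alpha1 \<omega> c" "b\<^sup>2 \<le> B * a\<^sup>2" for a b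
  proof -
    show a: "\<bar>a\<bar> \<le> sqrt (alpha1 \<omega> c)" using that by (intro real_le_rsqrt) simp
    have "B * a\<^sup>2 \<le> B * alpha1 \<omega> c" using that B by (intro mult_left_mono) auto
    then have b: "\<bar>b\<bar> \<le> sqrt (B * alpha1 \<omega> c)" using that by (intro real_le_rsqrt) simp
    show "\<bar>a\<bar> \<le> M" "\<bar>b\<bar> \<le> M" using a b alpha1_pos B unfolding M_def by (auto intro: add_increasing add_increasing2)
  qed
  have M: "0 \<le> M" using alpha1_pos B by (simp add: M_def)
  note PhiL = eventually_PhiL_profile
  have dPhiL: "\<forall>\<^sub>F L in at_top. \<forall>x. (deriv (PhiL \<omega> c L) x)\<^sup>2 \<le> B * (PhiL \<omega> c L x)\<^sup>2"
    using PhiL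
  proof eventually_elim
    case (elim L)
    then show ?case
      using profile_deriv_le[of "PhiL \<omega> c L" "deriv (PhiL \<omega> c L)"] by (auto simp: B_def)
  qed
  have "0 \<le> sqrt (alpha1 \<omega> c)" using alpha1_pos by simp
  from profile_continuous_dependence[OF this]
  obtain K where K: "\<And>u v U V x. profile u v \<Longrightarrow> profile U V \<Longrightarrow> \<forall>x. \<bar>u x\<bar> \<le> sqrt (alpha1 \<omega> c) \<Longrightarrow>
      \<forall>x. \<bar>U x\<bar> \<le> sqrt (alpha1 \<omega> c) \<Longrightarrow>
      (u x - U x)\<^sup>2 + (v x - V x)\<^sup>2 \<le> (u 0 - U 0)\<^sup>2 * exp (K * \<bar>x\<bar>)"
    by blast
  have Nexp: "\<forall>\<^sub>F L in at_top. \<forall>x. N L x \<le> (sqrt (eta3L \<omega> c L) - sqrt (alpha1 \<omega> c))\<^sup>2 * exp (K * \<bar>x\<bar>)"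
    using PhiL dPhiL
  proof eventually_elim
    case (elim L)
    show ?case
    proof
      fix x
      have "N L x \<le> (PhiL \<omega> c L 0 - Phi \<omega> c 0)\<^sup>2 * exp (K * \<bar>x\<bar>)"
        unfolding N_def using elim pPhi Phi_square_le dPhi by (intro K) (auto intro: bounds(1))
      then show "N L x \<le> (sqrt (eta3L \<omega> c L) - sqrt (alpha1 \<omega> c))\<^sup>2 * exp (K * \<bar>x\<bar>)"
        using elim by (simp add: Phi_0)
    qed
  qed
  have e0: "((\<lambda>L. (sqrt (eta3L \<omega> c L) - sqrt (alpha1 \<omega> c))\<^sup>2 * r) \<longlongrightarrow> 0) at_top" for r
  proof -
    have "((\<lambda>L. (sqrt (eta3L \<omega> c L) - sqrt (alpha1 \<omega> c))\<^sup>2 * r) \<longlongrightarrow> (sqrt (alpha1 \<omega> c) - sqrt (alpha1 \<omega> c))\<^sup>2 * r) at_top"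
      by (intro tendsto_intros eta3L_tendsto)
    then show ?thesis by simp
  qed
  have Nloc: "\<forall>\<^sub>F L in at_top. \<forall>x. \<bar>x\<bar> \<le> R \<longrightarrow> N L x \<le> \<epsilon>" if "0 < \<epsilon>" for R \<epsilon>
  proof -
    have "\<forall>\<^sub>F L in at_top. (sqrt (eta3L \<omega> c L) - sqrt (alpha1 \<omega> c))\<^sup>2 * exp (\<bar>K\<bar> * R) < \<epsilon>"
      by (rule order_tendstoD(2)[OF e0 that])
    with Nexp show ?thesis
    proof eventually_elim
      case (elim L)
      show ?case
      proof (intro allI impI)
        fix x :: real assume x: "\<bar>x\<bar> \<le> R"
        have "K * \<bar>x\<bar> \<le> \<bar>K\<bar> * R" using x by (intro mult_mono) auto
        then have "(sqrt (eta3L \<omega> c L) - sqrt (alpha1 \<omega> c))\<^sup>2 * exp (K * \<bar>x\<bar>)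
            \<le> (sqrt (eta3L \<omega> c L) - sqrt (alpha1 \<omega> c))\<^sup>2 * exp (\<bar>K\<bar> * R)"
          by (intro mult_left_mono) auto
        with elim show "N L x \<le> \<epsilon>" by (meson less_imp_le order_trans)
      qed
    qed
  qed
  obtain D where D: "\<forall>\<^sub>F L in at_top. \<forall>x. \<bar>x\<bar> \<le> L \<longrightarrow> (PhiL \<omega> c L x)\<^sup>2 \<le> D / (1 + x\<^sup>2)"
    using eventually_PhiL_dominated by blast
  have DPhi: "(Phi \<omega> c x)\<^sup>2 \<le> D / (1 + x\<^sup>2)" for x
  proof -
    have "((\<lambda>L. N L x) \<longlongrightarrow> 0) at_top"
    proof (rule tendsto_sandwich[OF _ _ tendsto_const e0])
      show "\<forall>\<^sub>F L in at_top. 0 \<le> N L x" by (simp add: N_def)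
      show "\<forall>\<^sub>F L in at_top. N L x \<le> (sqrt (eta3L \<omega> c L) - sqrt (alpha1 \<omega> c))\<^sup>2 * exp (K * \<bar>x\<bar>)"
        using Nexp by eventually_elim blast
    qed
    then have "((\<lambda>L. sqrt (N L x)) \<longlongrightarrow> 0) at_top" using tendsto_real_sqrt by fastforce
    then have "((\<lambda>L. PhiL \<omega> c L x - Phi \<omega> c x) \<longlongrightarrow> 0) at_top"
      by (rule Lim_null_comparison[rotated]) (auto intro!: always_eventually real_le_rsqrt simp: N_def)
    then have lim: "((\<lambda>L. PhiL \<omega> c L x) \<longlongrightarrow> Phi \<omega> c x) at_top" by (simp add: LIM_zero_iff)
    show ?thesis
    proof (rule tendsto_upperbound[OF tendsto_power[OF lim]])
      show "\<forall>\<^sub>F L in at_top. (PhiL \<omega> c L x)\<^sup>2 \<le> D / (1 + x\<^sup>2)"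
        using D eventually_ge_at_top[of "\<bar>x\<bar>"] by eventually_elim blast
    qed simp
  qed
  have Ndom: "\<forall>\<^sub>F L in at_top. \<forall>x. \<bar>x\<bar> \<le> L \<longrightarrow> N L x \<le> 4 * (1 + B) * (D / (1 + x\<^sup>2))"
    using D dPhiL
  proof eventually_elim
    case (elim L)
    show ?case
    proof (intro allI impI)
      fix x assume x: "\<bar>x\<bar> \<le> L"
      have sq: "(a - b)\<^sup>2 \<le> 2 * (a\<^sup>2 + b\<^sup>2)" for a b :: real
        using zero_le_power2[of "a + b"] by (simp add: power2_sum power2_diff)
      have "N L x \<le> 2 * ((PhiL \<omega> c L x)\<^sup>2 + (Phi \<omega> c x)\<^sup>2) + 2 * ((deriv (PhiL \<omega> c L) x)\<^sup>2 + (deriv (Phi \<omega> c) x)\<^sup>2)"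
        unfolding N_def by (intro add_mono sq)
      also have "\<dots> \<le> 2 * ((PhiL \<omega> c L x)\<^sup>2 + (Phi \<omega> c x)\<^sup>2) + 2 * (B * (PhiL \<omega> c L x)\<^sup>2 + B * (Phi \<omega> c x)\<^sup>2)"
        using elim(2) dPhi by (intro add_left_mono mult_left_mono add_mono) auto
      also have "\<dots> = 2 * (1 + B) * ((PhiL \<omega> c L x)\<^sup>2 + (Phi \<omega> c x)\<^sup>2)" by (simp add: algebra_simps)
      also have "\<dots> \<le> 2 * (1 + B) * (D / (1 + x\<^sup>2) + D / (1 + x\<^sup>2))"
        using elim(1) x DPhi[of x] B by (intro mult_left_mono add_mono) auto
      finally show "N L x \<le> 4 * (1 + B) * (D / (1 + x\<^sup>2))" by (simp add: algebra_simps add_divide_distrib)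
    qed
  qed
  have "((\<lambda>L. integral {-L..L} (\<lambda>x. ((deriv ^^ j) (\<lambda>x. PhiL \<omega> c L x - Phi \<omega> c x) x)\<^sup>2)) \<longlongrightarrow> 0) at_top" for j
  proof -
    obtain G where G: "G \<in> jet_polys" "\<And>u v U V. profile u v \<Longrightarrow> profile U V \<Longrightarrow>
        (deriv ^^ j) (\<lambda>x. u x - U x) = (\<lambda>x. G (u x) (v x) - G (U x) (V x))"
      using deriv_funpow_profile_diff by blast
    obtain A where A: "\<And>a b a' b'. \<bar>a\<bar> \<le> M \<Longrightarrow> \<bar>b\<bar> \<le> M \<Longrightarrow> \<bar>a'\<bar> \<le> M \<Longrightarrow> \<bar>b'\<bar> \<le> M
        \<Longrightarrow> \<bar>G a b - G a' b'\<bar> \<le> A * (\<bar>a - a'\<bar> + \<bar>b - b'\<bar>)"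
      using jet_polys_Lipschitz[OF G(1) M] by blast
    obtain G' where G': "\<And>u v x. profile u v \<Longrightarrow>
        ((\<lambda>x. G (u x) (v x)) has_real_derivative G' (u x) (v x)) (at x)"
      using jet_polys_deriv[OF G(1)] by blast
    let ?h = "\<lambda>L. (deriv ^^ j) (\<lambda>x. PhiL \<omega> c L x - Phi \<omega> c x)"
    \<comment> \<open>N alone controls every derivative, since (d + d')^2 \<le> 2 (d^2 +
      d'^2).\<close>
    have h: "\<forall>\<^sub>F L in at_top. \<forall>x. (?h L x)\<^sup>2 \<le> 2 * A\<^sup>2 * N L x"
      using PhiL dPhiL
    proof eventually_elim
      case (elim L)
      show ?case
      proof
        fix x
        let ?d = "\<bar>PhiL \<omega> c L x - Phi \<omega> c x\<bar>" and ?d' = "\<bar>deriv (PhiL \<omega> c L) x - deriv (Phi \<omega> c) x\<bar>"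
        have "\<bar>?h L x\<bar> \<le> A * (?d + ?d')"
          using elim G(2)[of "PhiL \<omega> c L" "deriv (PhiL \<omega> c L)", OF _ pPhi] Phi_square_le dPhi
          by (auto intro!: A intro: bounds)
        then have "\<bar>?h L x\<bar>\<^sup>2 \<le> (A * (?d + ?d'))\<^sup>2" by (intro power_mono) auto
        also have "\<dots> = A\<^sup>2 * (?d + ?d')\<^sup>2" by (simp add: power_mult_distrib)
        also have "\<dots> \<le> A\<^sup>2 * (2 * N L x)"
        proof (intro mult_left_mono)
          show "(?d + ?d')\<^sup>2 \<le> 2 * N L x"
            using sum_squares_bound[of ?d ?d'] by (simp add: N_def power2_sum)
        qed simp
        finally show "(?h L x)\<^sup>2 \<le> 2 * A\<^sup>2 * N L x" by (simp add: mult_ac)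
      qed
    qed
    show ?thesis
    proof (rule tendsto_integral_sq_zero[where B = "2 * A\<^sup>2 * (4 * (1 + B) * D)"])
      show "\<forall>\<^sub>F L in at_top. continuous_on UNIV (?h L)"
        using PhiL
      proof eventually_elim
        case (elim L)
        then have "?h L = (\<lambda>x. G (PhiL \<omega> c L x) (deriv (PhiL \<omega> c L) x) - G (Phi \<omega> c x) (deriv (Phi \<omega> c) x))"
          by (intro G(2) pPhi) auto
        moreover have "continuous_on UNIV (\<lambda>x. G (u x) (v x))" if "profile u v" for u v
          using G'[OF that] by (intro DERIV_continuous_on) (auto intro: has_field_derivative_at_within)
        ultimately show ?case using elim pPhi by (auto intro!: continuous_on_diff)
      qed
      show "\<forall>\<^sub>F L in at_top. \<forall>x. \<bar>x\<bar> \<le> L \<longrightarrow> (?h L x)\<^sup>2 \<le> 2 * A\<^sup>2 * (4 * (1 + B) * D) / (1 + x\<^sup>2)"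
        using h Ndom
      proof eventually_elim
        case (elim L)
        show ?case
        proof (intro allI impI)
          fix x assume "\<bar>x\<bar> \<le> L"
          with elim(2) have "2 * A\<^sup>2 * N L x \<le> 2 * A\<^sup>2 * (4 * (1 + B) * (D / (1 + x\<^sup>2)))"
            by (intro mult_left_mono) auto
          then show "(?h L x)\<^sup>2 \<le> 2 * A\<^sup>2 * (4 * (1 + B) * D) / (1 + x\<^sup>2)"
            using elim(1) by (auto intro: order_trans)
        qed
      qed
      fix R \<epsilon> :: real assume "0 < R" "0 < \<epsilon>"
      \<comment> \<open>The summand 1 keeps the denominator positive when A = 0.\<close>
      have "0 < 2 * A\<^sup>2 + 1" by (intro add_nonneg_pos) auto
      then have "\<forall>\<^sub>F L in at_top. \<forall>x. \<bar>x\<bar> \<le> R \<longrightarrow> N L x \<le> \<epsilon> / (2 * A\<^sup>2 + 1)"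
        using \<open>0 < \<epsilon>\<close> by (intro Nloc) auto
      with h show "\<forall>\<^sub>F L in at_top. \<forall>x. \<bar>x\<bar> \<le> R \<longrightarrow> (?h L x)\<^sup>2 \<le> \<epsilon>"
      proof eventually_elim
        case (elim L)
        show ?case
        proof (intro allI impI)
          fix x assume "\<bar>x\<bar> \<le> R"
          with elim(2) have "2 * A\<^sup>2 * N L x \<le> 2 * A\<^sup>2 * (\<epsilon> / (2 * A\<^sup>2 + 1))"
            by (intro mult_left_mono) auto
          also have "\<dots> \<le> \<epsilon>"
            using \<open>0 < 2 * A\<^sup>2 + 1\<close> \<open>0 < \<epsilon>\<close> by (simp add: field_simps)
          finally show "(?h L x)\<^sup>2 \<le> \<epsilon>" using elim(1) order_trans by blast
        qed
      qed
    qed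
  qed
  then have "((\<lambda>L. sqrt (\<Sum>j\<le>m. integral {-L..L} (\<lambda>x. ((deriv ^^ j) (\<lambda>x. PhiL \<omega> c L x - Phi \<omega> c x) x)\<^sup>2)))
      \<longlongrightarrow> sqrt (\<Sum>j\<le>m. 0)) at_top"
    by (intro tendsto_intros)
  then show ?thesis by (simp add: Hm_norm_def)
qed

end

theorem theorem1p2:
  fixes \<omega> c :: real and m :: nat
  assumes "\<omega> > c\<^sup>2 / 4 \<or> (\<omega> = c\<^sup>2 / 4 \<and> c > 0)"
  shows "((\<lambda>L. Hm_norm m L (\<lambda>x. PhiL \<omega> c L x - Phi \<omega> c x)) \<longlongrightarrow> 0) at_top"
proof -
  interpret wave_parameters \<omega> c by unfold_locales (fact assms)
  show ?thesis by (rule Hm_norm_diff_tendsto_zero)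
qed

end
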